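(* Let $\mathcal{H}$ be an infinite dimensional Hilbert space, let $\{g_n\}_{n\in\mathbb{N}}\subset\mathcal{H}$ be a sequence and let $A:\mathcal{D}(A)\subseteq\mathcal{H}\to\mathcal{H}$ be a closed densely defined linear operator. Let $\mathcal{H}_A$ denote the Hilbert space $\mathcal{D}(A)$ endowed with the graph inner product $\langle\cdot|\cdot\rangle_A$. Then the following are equivalent. (i) $\{g_n\}$ is an atomic system for $A$. (ii) $\{g_n\}$ is an $A$-frame. (iii) $\{g_n\}$ is a Bessel sequence of $\mathcal{H}$ and there exists a Bessel sequence $\{k_n\}$ of $\mathcal{H}_A$ such that $$Af=\sum_{n=1}^\infty\langle f|k_n\rangle_A\,g_n\qquad\text{for all } f\in\mathcal{D}(A),$$ with convergence in the norm of $\mathcal{H}$. (iv) The synthesis operator $D$ of $\{g_n\}$ is bounded and everywhere defined on $\ell^2$, and $\mathcal{R}(A)\subset\mathcal{R}(D)$. (v) The synthesis operator $D$ of $\{g_n\}$ is bounded and everywhere defined on $\ell^2$, and there exists a bounded linear operator $M:\mathcal{H}_A\to\ell^2$ such that $A=DM$.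
   Context: $\mathcal{H}$ is a complex Hilbert space with inner product $\langle\cdot|\cdot\rangle$ (linear in the first argument) and norm $\|\cdot\|$; $\ell^2$ is the Hilbert space of square-summable complex sequences; $\mathcal{R}(\cdot)$ denotes the range. The graph inner product is $\langle f|g\rangle_A=\langle f|g\rangle+\langle Af|Ag\rangle$ for $f,g\in\mathcal{D}(A)$, with norm $\|\cdot\|_A$ (graph norm). Viewed as an operator from $\mathcal{H}_A$ to $\mathcal{H}$, $A$ is bounded; $A^\sharp:\mathcal{H}\to\mathcal{H}_A$ denotes the adjoint of this bounded operator $A:\mathcal{H}_A\to\mathcal{H}$ (not the adjoint $A^*$ of the unbounded operator). A sequence $\{x_n\}$ in a Hilbert space $\mathcal{K}$ is a Bessel sequence of $\mathcal{K}$ if there is $\beta>0$ with $\sum_{n=1}^\infty|\langle f|x_n\rangle_{\mathcal{K}}|^2\le\beta\|f\|_{\mathcal{K}}^2$ for all $f\in\mathcal{K}$. The sequence $\{g_n\}\subset\mathcal{H}$ is an atomic system for $A$ if $\{g_n\}$ is a Bessel sequence of $\mathcal{H}$ and there exists $\gamma>0$ such that for all $f\in\mathcal{D}(A)$ there exists $a_f=\{a_n(f)\}\in\ell^2$ with $\|a_f\|\le\gamma\|f\|_A$ and $Af=\sum_{n=1}^\infty a_n(f)g_n$ with respect to the norm of $\mathcal{H}$. The sequence $\{g_n\}\subset\mathcal{H}$ is an $A$-frame if there exist $\alpha,\beta>0$ such that $\alpha\|A^\sharp f\|_A^2\le\sum_{n=1}^\infty|\langle f|g_n\rangle|^2\le\beta\|f\|^2$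 for every $f\in\mathcal{H}$. The synthesis operator $D:\mathcal{D}(D)\subseteq\ell^2\to\mathcal{H}$ of $\{g_n\}$ has domain $\mathcal{D}(D)=\{\{c_n\}\in\ell^2:\sum_{n=1}^\infty c_ng_n\text{ converges in }\mathcal{H}\}$ and is given by $D\{c_n\}=\sum_{n=1}^\infty c_ng_n$. *)

theory Defs
  imports "HOL-Analysis.Analysis"
begin

section \<open>Complex Hilbert spaces\<close>

text \<open>The inner product is linear in its first argument. The norm, metric and topology are those
  of the superclass \<^class>\<open>real_normed_vector\<close>, tied to the inner product by the last axiom.\<close>

class complex_inner = real_normed_vector +
  fixes scaleC :: "complex \<Rightarrow> 'a \<Rightarrow> 'a" (infixr "*\<^sub>C" 75)
    and cinner :: "'a \<Rightarrow> 'a \<Rightarrow> complex"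
  assumes scaleR_scaleC: "scaleR r x = complex_of_real r *\<^sub>C x"
    and scaleC_add_right: "a *\<^sub>C (x + y) = a *\<^sub>C x + a *\<^sub>C y"
    and scaleC_add_left: "(a + b) *\<^sub>C x = a *\<^sub>C x + b *\<^sub>C x"
    and scaleC_scaleC: "a *\<^sub>C (b *\<^sub>C x) = (a * b) *\<^sub>C x"
    and scaleC_one: "1 *\<^sub>C x = x"
    and cinner_commute: "cinner x y = cnj (cinner y x)"
    and cinner_add_left: "cinner (x + y) z = cinner x z + cinner y z"
    and cinner_scaleC_left: "cinner (a *\<^sub>C x) y = a * cinner x y"
    and norm_eq_sqrt_cinner: "norm x = sqrt (Re (cinner x x))"

class complex_hilbert = complex_inner + complete_space

interpretation complex_vector: vector_space "scaleC :: complex \<Rightarrow> 'a \<Rightarrow> 'a::complex_inner"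
  by unfold_locales (simp_all add: scaleC_add_right scaleC_add_left scaleC_scaleC scaleC_one)

definition infinite_dimensional :: "'a::complex_inner itself \<Rightarrow> bool" where
  "infinite_dimensional _ \<longleftrightarrow> \<not> (\<exists>B :: 'a set. finite B \<and> complex_vector.span B = UNIV)"


section \<open>Unbounded operators and the graph inner product\<close>

text \<open>An operator with domain \<open>S\<close> is a pair of \<open>S\<close> and a total function \<open>A\<close> whose values
  outside \<open>S\<close> are irrelevant.\<close>

definition closed_densely_defined_operator ::
    "'a::complex_inner set \<Rightarrow> ('a \<Rightarrow> 'a) \<Rightarrow> bool" where
  "closed_densely_defined_operator S A \<longleftrightarrow>
     complex_vector.subspace S \<and>
     (\<forall>f\<in>S. \<forall>h\<in>S. A (f + h) = A f + A h) \<and>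
     (\<forall>c. \<forall>f\<in>S. A (c *\<^sub>C f) = c *\<^sub>C A f) \<and>
     closed {(f, A f) |f. f \<in> S} \<and>
     closure S = UNIV"

definition graph_inner :: "('a::complex_inner \<Rightarrow> 'a) \<Rightarrow> 'a \<Rightarrow> 'a \<Rightarrow> complex" where
  "graph_inner A f h = cinner f h + cinner (A f) (A h)"

definition graph_norm :: "('a::complex_inner \<Rightarrow> 'a) \<Rightarrow> 'a \<Rightarrow> real" where
  "graph_norm A f = sqrt (Re (graph_inner A f f))"

text \<open>The Hilbert space adjoint of the bounded operator \<open>A\<close> from \<open>S\<close> with the graph inner product
  to the whole space, not the adjoint of the unbounded operator \<open>A\<close>. If \<open>A\<close> is closed, \<open>S\<close> is
  complete for the graph norm, so by the Riesz representation theorem exactly one such \<open>h\<close> exists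
  for each \<open>f\<close>.\<close>

definition graph_adjoint :: "'a::complex_inner set \<Rightarrow> ('a \<Rightarrow> 'a) \<Rightarrow> 'a \<Rightarrow> 'a" where
  "graph_adjoint S A f = (THE h. h \<in> S \<and> (\<forall>u\<in>S. cinner (A u) f = graph_inner A u h))"


section \<open>Bessel sequences, atomic systems and frames\<close>

text \<open>The Hilbert space is given by its carrier \<open>K\<close> and its inner product \<open>ip\<close>, so that the notion
  covers both the ambient space and the domain of an operator with its graph inner product.
  Summability has to be demanded because \<^const>\<open>suminf\<close> is unspecified on divergent series.\<close>

definition bessel_sequence ::
    "'a set \<Rightarrow> ('a \<Rightarrow> 'a \<Rightarrow> complex) \<Rightarrow> (nat \<Rightarrow> 'a) \<Rightarrow> bool" where
  "bessel_sequence K ip x \<longleftrightarrow>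
     (\<forall>n. x n \<in> K) \<and>
     (\<exists>\<beta>>0. \<forall>f\<in>K. summable (\<lambda>n. (cmod (ip f (x n)))\<^sup>2) \<and>
        (\<Sum>n. (cmod (ip f (x n)))\<^sup>2) \<le> \<beta> * (sqrt (Re (ip f f)))\<^sup>2)"

definition ell2 :: "(nat \<Rightarrow> complex) set" where
  "ell2 = {c. summable (\<lambda>n. (cmod (c n))\<^sup>2)}"

definition ell2_norm :: "(nat \<Rightarrow> complex) \<Rightarrow> real" where
  "ell2_norm c = sqrt (\<Sum>n. (cmod (c n))\<^sup>2)"

definition atomic_system ::
    "'a::complex_inner set \<Rightarrow> ('a \<Rightarrow> 'a) \<Rightarrow> (nat \<Rightarrow> 'a) \<Rightarrow> bool" where
  "atomic_system S A g \<longleftrightarrow>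
     bessel_sequence UNIV cinner g \<and>
     (\<exists>\<gamma>>0. \<forall>f\<in>S. \<exists>a\<in>ell2.
        ell2_norm a \<le> \<gamma> * graph_norm A f \<and> (\<lambda>n. a n *\<^sub>C g n) sums A f)"

definition operator_frame ::
    "'a::complex_inner set \<Rightarrow> ('a \<Rightarrow> 'a) \<Rightarrow> (nat \<Rightarrow> 'a) \<Rightarrow> bool" where
  "operator_frame S A g \<longleftrightarrow>
     (\<exists>\<alpha>>0. \<exists>\<beta>>0. \<forall>f.
        summable (\<lambda>n. (cmod (cinner f (g n)))\<^sup>2) \<and>
        \<alpha> * (graph_norm A (graph_adjoint S A f))\<^sup>2 \<le> (\<Sum>n. (cmod (cinner f (g n)))\<^sup>2) \<and>
        (\<Sum>n. (cmod (cinner f (g n)))\<^sup>2) \<le> \<beta> * (norm f)\<^sup>2)"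


section \<open>The synthesis operator\<close>

definition synthesis_domain :: "(nat \<Rightarrow> 'a::complex_inner) \<Rightarrow> (nat \<Rightarrow> complex) set" where
  "synthesis_domain g = {c \<in> ell2. summable (\<lambda>n. c n *\<^sub>C g n)}"

definition synthesis :: "(nat \<Rightarrow> 'a::complex_inner) \<Rightarrow> (nat \<Rightarrow> complex) \<Rightarrow> 'a" where
  "synthesis g c = (\<Sum>n. c n *\<^sub>C g n)"

definition synthesis_range :: "(nat \<Rightarrow> 'a::complex_inner) \<Rightarrow> 'a set" where
  "synthesis_range g = synthesis g ` synthesis_domain g"

definition synthesis_bounded_everywhere_defined :: "(nat \<Rightarrow> 'a::complex_inner) \<Rightarrow> bool" where
  "synthesis_bounded_everywhere_defined g \<longleftrightarrow>
     synthesis_domain g = ell2 \<and>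
     (\<exists>C. \<forall>c\<in>synthesis_domain g. norm (synthesis g c) \<le> C * ell2_norm c)"

text \<open>Bounded linear operators into \<^const>\<open>ell2\<close> from \<open>S\<close> with the graph norm of \<open>A\<close>.\<close>

definition graph_bounded_linear_ell2 ::
    "'a::complex_inner set \<Rightarrow> ('a \<Rightarrow> 'a) \<Rightarrow> ('a \<Rightarrow> nat \<Rightarrow> complex) \<Rightarrow> bool" where
  "graph_bounded_linear_ell2 S A M \<longleftrightarrow>
     (\<forall>f\<in>S. M f \<in> ell2) \<and>
     (\<forall>f\<in>S. \<forall>h\<in>S. M (f + h) = (\<lambda>n. M f n + M h n)) \<and>
     (\<forall>c. \<forall>f\<in>S. M (c *\<^sub>C f) = (\<lambda>n. c * M f n)) \<and>
     (\<exists>C. \<forall>f\<in>S. ell2_norm (M f) \<le> C * graph_norm A f)"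

end

theory Submission
  imports Defs
begin

text \<open>A sequence is Bessel iff its synthesis operator \<open>D\<close> is bounded and everywhere defined, and
  the Hilbert space of \<open>A\<close> with the graph norm is the graph of \<open>A\<close>, a closed subspace of the
  product of the ambient space with itself. The equivalences follow from the cycle
  (i) \<open>\<Longrightarrow>\<close> (iv) \<open>\<Longrightarrow>\<close> (ii) \<open>\<Longrightarrow>\<close> (v) \<open>\<Longrightarrow>\<close> (iii) \<open>\<Longrightarrow>\<close> (i). Its essential steps are the two halves of
  Douglas' factorisation argument: (iv) \<open>\<Longrightarrow>\<close> (ii) is uniform boundedness on the graph,
  (ii) \<open>\<Longrightarrow>\<close> (v) is the Riesz representation of functionals on the range of \<open>D\<^sup>*\<close>. The Riesz vectors
  of the coordinate functionals of \<open>M\<close> are the \<open>k\<^sub>n\<close> of (iii).\<close>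

section \<open>Complex inner product spaces\<close>

lemma cinner_self: "cinner x x = complex_of_real ((norm x)\<^sup>2)" for x :: "'a::complex_inner"
proof -
  have im: "Im (cinner x x) = 0"
    using arg_cong[OF cinner_commute[of x x], of Im] by simp
  \<comment> \<open>Positivity is not an axiom of the class. In HOL \<open>sqrt\<close> is odd, so a
    nonnegative norm forces \<open>Re (cinner x x)\<close> to be nonnegative.\<close>
  have "0 \<le> sqrt (Re (cinner x x))"
    using norm_ge_zero[of x] unfolding norm_eq_sqrt_cinner .
  then have "Re (cinner x x) = (norm x)\<^sup>2"
    by (simp add: norm_eq_sqrt_cinner)
  with im show ?thesis by (simp add: complex_eq_iff)
qed

lemma cinner_add_right: "cinner x (y + z) = cinner x y + cinner x z"
  for x y z :: "'a::complex_inner"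
  using cinner_commute[of x "y + z"] cinner_commute[of x y] cinner_commute[of x z]
  by (simp add: cinner_add_left)

lemma cinner_scaleC_right: "cinner x (a *\<^sub>C y) = cnj a * cinner x y"
  for x y :: "'a::complex_inner"
  using cinner_commute[of x "a *\<^sub>C y"] cinner_commute[of x y] by (simp add: cinner_scaleC_left)

lemma norm_scaleC: "norm (a *\<^sub>C x) = cmod a * norm x" for x :: "'a::complex_inner"
proof -
  have "complex_of_real ((norm (a *\<^sub>C x))\<^sup>2) = complex_of_real ((cmod a * norm x)\<^sup>2)"
    unfolding cinner_self[symmetric] cinner_scaleC_left cinner_scaleC_right
    by (simp only: cinner_self power_mult_distrib of_real_mult complex_norm_square[of a]) simp
  then show ?thesis
    by (subst (asm) of_real_eq_iff) (rule power2_eq_imp_eq, auto)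
qed

lemma norm_add_sq: "(norm (x + y))\<^sup>2 = (norm x)\<^sup>2 + 2 * Re (cinner x y) + (norm y)\<^sup>2"
  for x y :: "'a::complex_inner"
proof -
  have "complex_of_real ((norm (x + y))\<^sup>2) = cinner (x + y) (x + y)"
    by (simp only: cinner_self)
  also have "\<dots> = of_real ((norm x)\<^sup>2) + (cinner x y + cinner y x) + of_real ((norm y)\<^sup>2)"
    unfolding cinner_self[symmetric] by (simp add: cinner_add_left cinner_add_right add_ac)
  finally have "(norm (x + y))\<^sup>2 = Re (\<dots>)" by (metis Re_complex_of_real)
  then show ?thesis
    using cinner_commute[of y x] by simp
qed

lemma Cauchy_Schwarz_cinner: "cmod (cinner x y) \<le> norm x * norm y"
  for x y :: "'a::complex_inner"
proof (cases "y = 0")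
  case True
  have "cinner x (0 *\<^sub>C y) = 0" by (simp only: cinner_scaleC_right) simp
  with True show ?thesis by simp
next
  case False
  \<comment> \<open>With this coefficient \<open>x + c *\<^sub>C y\<close> is \<open>x\<close> minus
    its orthogonal projection onto the line of \<open>y\<close>; its squared norm being nonnegative
    is the claim.\<close>
  define c where "c = - cinner x y / of_real ((norm y)\<^sup>2)"
  have "0 \<le> (norm (x + c *\<^sub>C y))\<^sup>2" by simp
  also have "\<dots> = (norm x)\<^sup>2 + 2 * Re (cnj c * cinner x y) + (cmod c * norm y)\<^sup>2"
    unfolding norm_add_sq by (simp add: cinner_scaleC_right norm_scaleC)
  also have "cnj c * cinner x y = - of_real ((cmod (cinner x y))\<^sup>2 / (norm y)\<^sup>2)"
    unfolding c_def by (simp add: complex_norm_square[symmetric] mult.commute[of "cnj _"])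
  also have "(cmod c * norm y)\<^sup>2 = (cmod (cinner x y))\<^sup>2 / (norm y)\<^sup>2"
  proof -
    have "cmod c = cmod (cinner x y) / (norm y)\<^sup>2"
      by (simp add: c_def norm_divide norm_power)
    then show ?thesis using False by (simp add: field_simps power2_eq_square)
  qed
  finally have "(cmod (cinner x y))\<^sup>2 / (norm y)\<^sup>2 \<le> (norm x)\<^sup>2" by simp
  then have "(cmod (cinner x y))\<^sup>2 \<le> (norm x * norm y)\<^sup>2"
    using False by (simp add: field_simps power_mult_distrib)
  then show ?thesis by (rule power2_le_imp_le) simp
qed

lemma bounded_bilinear_cinner: "bounded_bilinear (cinner :: 'a::complex_inner \<Rightarrow> 'a \<Rightarrow> complex)"
proof
  show "\<exists>K. \<forall>a b::'a. norm (cinner a b) \<le> norm a * norm b * K"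
    by (intro exI[of _ 1]) (simp add: Cauchy_Schwarz_cinner)
qed (simp_all add: cinner_add_left cinner_add_right scaleR_scaleC cinner_scaleC_left
    cinner_scaleC_right scaleR_conv_of_real)

interpretation cinner: bounded_bilinear "cinner :: 'a::complex_inner \<Rightarrow> 'a \<Rightarrow> complex"
  by (rule bounded_bilinear_cinner)

lemma norm_diff_sq: "(norm (x - y))\<^sup>2 = (norm x)\<^sup>2 - 2 * Re (cinner x y) + (norm y)\<^sup>2"
  for x y :: "'a::complex_inner"
  using norm_add_sq[of x "- y"] by (simp add: cinner.minus_right)

lemma parallelogram:
  "(norm (x - y))\<^sup>2 = 2 * (norm x)\<^sup>2 + 2 * (norm y)\<^sup>2 - (norm (x + y))\<^sup>2"
  for x y :: "'a::complex_inner"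
  by (simp add: norm_diff_sq norm_add_sq)

instance complex_hilbert \<subseteq> banach ..

section \<open>Subspaces and their closures, Riesz representation, uniform boundedness\<close>

lemma csubspace_closure:
  fixes V :: "'a::complex_inner set"
  assumes "complex_vector.subspace V"
  shows "complex_vector.subspace (closure V)"
  unfolding complex_vector.subspace_def
proof (intro conjI ballI allI)
  show "0 \<in> closure V"
    using complex_vector.subspace_0[OF assms] closure_subset by blast
next
  fix x y assume "x \<in> closure V" "y \<in> closure V"
  then obtain X Y where "\<forall>n. X n \<in> V" "X \<longlonglongrightarrow> x" "\<forall>n. Y n \<in> V" "Y \<longlonglongrightarrow> y"
    unfolding closure_sequential by blast
  then show "x + y \<in> closure V"
    unfolding closure_sequential
    by (intro exI[of _ "\<lambda>n. X n + Y n"])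
      (simp add: complex_vector.subspace_add[OF assms] tendsto_add)
next
  fix c x assume "x \<in> closure V"
  then obtain X where X: "\<forall>n. X n \<in> V" "X \<longlonglongrightarrow> x"
    unfolding closure_sequential by blast
  have "bounded_linear (\<lambda>x::'a. c *\<^sub>C x)"
    by (rule bounded_linear_intro[where K = "cmod c"])
      (simp_all add: scaleC_add_right scaleR_scaleC scaleC_scaleC norm_scaleC mult.commute)
  from bounded_linear.tendsto[OF this X(2)] X(1) show "c *\<^sub>C x \<in> closure V"
    unfolding closure_sequential
    by (intro exI[of _ "\<lambda>n. c *\<^sub>C X n"]) (simp add: complex_vector.subspace_scale[OF assms])
qed

text \<open>The difference is orthogonal to \<open>V\<close>, hence by continuity to the closure of
  \<open>V\<close>, in which it lies itself. This is the uniqueness half of the Riesz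
  representation; it yields the uniqueness of \<open>A\<^sup>\<sharp> f\<close> and the linearity of
  \<open>M\<close>.\<close>

lemma cinner_eq_closure_imp_eq:
  fixes V :: "'a::complex_inner set"
  assumes V: "complex_vector.subspace V"
    and xy: "x \<in> closure V" "y \<in> closure V"
    and eq: "\<And>v. v \<in> V \<Longrightarrow> cinner v x = cinner v y"
  shows "x = y"
proof -
  have "x - y \<in> closure V"
    using complex_vector.subspace_diff[OF csubspace_closure[OF V] xy] .
  then obtain X where X: "\<forall>n. X n \<in> V" "X \<longlonglongrightarrow> x - y"
    unfolding closure_sequential by blast
  have "(\<lambda>n. cinner (X n) (x - y)) \<longlonglongrightarrow> cinner (x - y) (x - y)"
    by (intro cinner.tendsto X tendsto_const)
  moreover have "cinner (X n) (x - y) = 0" for n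
    using X(1) eq by (simp add: cinner.diff_right)
  ultimately have "cinner (x - y) (x - y) = 0"
    by (simp add: LIMSEQ_const_iff)
  then show ?thesis by (simp add: cinner_self)
qed

text \<open>The representing vector is the limit of a minimising sequence of
  \<open>\<parallel>v\<parallel>\<^sup>2 - 2 Re (\<phi> v)\<close> over \<open>V\<close>; hence \<open>V\<close> need not be closed.\<close>

lemma riesz_representation:
  fixes V :: "'a::complex_hilbert set"
  assumes V: "complex_vector.subspace V"
    and add: "\<And>v w. v \<in> V \<Longrightarrow> w \<in> V \<Longrightarrow> \<phi> (v + w) = \<phi> v + \<phi> w"
    and scale: "\<And>c v. v \<in> V \<Longrightarrow> \<phi> (c *\<^sub>C v) = c * \<phi> v"
    and bound: "\<And>v. v \<in> V \<Longrightarrow> cmod (\<phi> v) \<le> C * norm v"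
    and C: "0 \<le> C"
  obtains h where "h \<in> closure V" "\<And>v. v \<in> V \<Longrightarrow> \<phi> v = cinner v h" "norm h \<le> C"
proof -
  define J where "J v = (norm v)\<^sup>2 - 2 * Re (\<phi> v)" for v
  define m where "m = Inf (J ` V)"
  \<comment> \<open>Completing the square in \<open>norm v\<close> shows that the infimum
    \<open>m\<close> is finite.\<close>
  have lower: "- C\<^sup>2 \<le> J v" if "v \<in> V" for v
  proof -
    have "Re (\<phi> v) \<le> C * norm v"
      using bound[OF that] complex_Re_le_cmod order_trans by blast
    moreover have "0 \<le> (norm v - C)\<^sup>2" by simp
    ultimately show ?thesis unfolding J_def power2_diff by (simp add: mult.commute)
  qed
  have bdd: "bdd_below (J ` V)" using lower by (intro bdd_belowI2) auto
  have ge_m: "m \<le> J v" if "v \<in> V" for v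
    unfolding m_def using bdd that by (intro cInf_lower) auto
  have ne: "J ` V \<noteq> {}" using complex_vector.subspace_0[OF V] by auto
  have "\<exists>v\<in>V. J v < m + inverse (real (Suc n))" for n
    using cInf_lessD[OF ne, of "m + inverse (real (Suc n))"] unfolding m_def by auto
  then obtain x where xV: "\<And>n. x n \<in> V" and x: "\<And>n. J (x n) < m + inverse (real (Suc n))"
    by metis
  have half: "(1/2 :: complex) *\<^sub>C (v + w) \<in> V" if "v \<in> V" "w \<in> V" for v w
    using that by (intro complex_vector.subspace_scale[OF V] complex_vector.subspace_add[OF V])
  \<comment> \<open>The midpoint of \<open>v\<close> and \<open>w\<close> is in \<open>V\<close>, so
    \<open>J\<close> is at least \<open>m\<close> there; by the parallelogram law near-minimisers
    are close to each other, and minimising sequences are Cauchy.\<close>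
  have close: "(norm (v - w))\<^sup>2 \<le> 2 * (J v - m) + 2 * (J w - m)" if "v \<in> V" "w \<in> V" for v w
  proof -
    have "4 * J ((1/2 :: complex) *\<^sub>C (v + w)) = (norm (v + w))\<^sup>2 - 4 * (Re (\<phi> v) + Re (\<phi> w))"
      unfolding J_def using that complex_vector.subspace_add[OF V that]
      by (simp add: scale add norm_scaleC norm_divide power_divide add_divide_distrib)
    with ge_m[OF half[OF that]] show ?thesis
      unfolding parallelogram by (simp add: J_def)
  qed
  have "Cauchy x"
  proof (rule metric_CauchyI)
    fix e :: real assume e: "0 < e"
    obtain N where N: "inverse (real (Suc N)) < e\<^sup>2 / 4"
      using reals_Archimedean[of "e\<^sup>2 / 4"] e by auto
    have small: "2 * (J (x n) - m) < e\<^sup>2 / 2" if "N \<le> n" for n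
    proof -
      have "inverse (real (Suc n)) \<le> inverse (real (Suc N))" using that by simp
      then have "J (x n) - m < e\<^sup>2 / 4" using x[of n] N by linarith
      then show ?thesis by simp
    qed
    have "dist (x p) (x q) < e" if "N \<le> p" "N \<le> q" for p q
    proof -
      have "(norm (x p - x q))\<^sup>2 < e\<^sup>2 / 2 + e\<^sup>2 / 2"
        by (rule le_less_trans[OF close[OF xV xV] add_strict_mono[OF small small]]) fact+
      then show ?thesis
        unfolding dist_norm field_sum_of_halves by (rule power2_less_imp_less) (use e in simp)
    qed
    then show "\<exists>M. \<forall>p\<ge>M. \<forall>q\<ge>M. dist (x p) (x q) < e" by blast
  qed
  then obtain h where h: "x \<longlonglongrightarrow> h"
    using Cauchy_convergent_iff convergentD by blast
  have Jlim: "(\<lambda>n. J (x n)) \<longlonglongrightarrow> m"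
  proof (rule tendsto_sandwich)
    show "(\<lambda>n. m) \<longlonglongrightarrow> m" by simp
    show "(\<lambda>n. m + inverse (real (Suc n))) \<longlonglongrightarrow> m"
      using tendsto_add[OF tendsto_const LIMSEQ_inverse_real_of_nat, of m] by simp
  qed (use ge_m[OF xV] less_imp_le[OF x] in \<open>simp_all only: eventually_True\<close>)
  \<comment> \<open>First variation of \<open>J\<close>. The limit \<open>h\<close> may lie outside
    \<open>V\<close>, where nothing is known of \<open>\<phi>\<close>, so \<open>x n\<close> is
    compared with \<open>x n + w\<close> before \<open>n\<close> tends to infinity.\<close>
  have var: "0 \<le> 2 * Re (cinner w h - \<phi> w) + (norm w)\<^sup>2" if w: "w \<in> V" for w
  proof -
    have "m \<le> J (x n) + 2 * Re (cinner w (x n) - \<phi> w) + (norm w)\<^sup>2" for n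
    proof -
      have "m \<le> J (x n + w)" by (intro ge_m complex_vector.subspace_add[OF V] xV w)
      then show ?thesis
        using cinner_commute[of "x n" w] by (simp add: J_def norm_add_sq add xV w)
    qed
    moreover have "(\<lambda>n. J (x n) + 2 * Re (cinner w (x n) - \<phi> w) + (norm w)\<^sup>2)
        \<longlonglongrightarrow> m + 2 * Re (cinner w h - \<phi> w) + (norm w)\<^sup>2"
      by (intro tendsto_intros Jlim cinner.tendsto h)
    ultimately have "m \<le> m + 2 * Re (cinner w h - \<phi> w) + (norm w)\<^sup>2"
      by (intro LIMSEQ_le_const) auto
    then show ?thesis by simp
  qed
  have repr: "\<phi> v = cinner v h" if v: "v \<in> V" for v
  proof -
    \<comment> \<open>The defect \<open>d\<close> must vanish. Along \<open>c *\<^sub>C v\<close>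
      the linear term of \<open>var\<close> is -2 times \<open>s * (cmod d)\<^sup>2\<close>, while
      the quadratic term is the same quantity times \<open>s * (norm v)\<^sup>2\<close>, which the
      choice of \<open>s\<close> keeps below 1.\<close>
    define d where "d = cinner v h - \<phi> v"
    define s where "s = inverse (1 + (norm v)\<^sup>2)"
    define c where "c = - of_real s * cnj d"
    have pos: "0 < 1 + (norm v)\<^sup>2" by (simp add: add_pos_nonneg)
    then have s: "0 < s" "s * (norm v)\<^sup>2 < 1" by (auto simp: s_def field_simps)
    have "c * d = - of_real (s * (cmod d)\<^sup>2)"
      by (simp only: c_def of_real_mult complex_norm_square) (simp add: algebra_simps)
    moreover have "cinner (c *\<^sub>C v) h - \<phi> (c *\<^sub>C v) = c * d"
      by (simp add: cinner_scaleC_left scale v d_def right_diff_distrib)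
    moreover have "(norm (c *\<^sub>C v))\<^sup>2 = s * (cmod d)\<^sup>2 * (s * (norm v)\<^sup>2)"
      using s by (simp add: norm_scaleC c_def norm_mult power_mult_distrib power2_eq_square)
    ultimately have "0 \<le> s * (cmod d)\<^sup>2 * (s * (norm v)\<^sup>2 - 2)"
      using var[OF complex_vector.subspace_scale[OF V v, of c]]
      by (simp add: right_diff_distrib)
    moreover have "s * (norm v)\<^sup>2 - 2 < 0" using s by linarith
    ultimately have "s * (cmod d)\<^sup>2 \<le> 0"
      by (simp add: zero_le_mult_iff)
    then have "d = 0" using s by (simp add: mult_le_0_iff)
    then show ?thesis by (simp add: d_def)
  qed
  \<comment> \<open>The representation is available on \<open>V\<close> only, so \<open>h\<close> is
    paired with the \<open>x n\<close> and the limit is taken; cancelling \<open>norm h\<close> then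
    leaves \<open>C\<close>.\<close>
  have "cmod (cinner h h) \<le> C * norm h"
  proof (rule LIMSEQ_le)
    show "(\<lambda>n. cmod (cinner (x n) h)) \<longlonglongrightarrow> cmod (cinner h h)"
      by (intro tendsto_norm cinner.tendsto h tendsto_const)
    show "(\<lambda>n. C * norm (x n)) \<longlonglongrightarrow> C * norm h"
      by (intro tendsto_intros h)
    show "\<exists>N. \<forall>n\<ge>N. cmod (cinner (x n) h) \<le> C * norm (x n)"
      using bound[OF xV] repr[OF xV] by auto
  qed
  then have "norm h * norm h \<le> C * norm h"
    by (simp add: cinner_self norm_power flip: power2_eq_square)
  then have "norm h \<le> C"
    using C by (cases "h = 0") auto
  moreover have "h \<in> closure V"
    unfolding closure_sequential using xV h by blast
  ultimately show ?thesis using repr that by blast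
qed

text \<open>Gliding hump: an unbounded family would allow one to choose \<open>h\<^sub>n\<close> with \<open>\<parallel>h\<^sub>n\<parallel> \<ge> 4\<^sup>n\<close>
  and signs such that \<open>v = \<Sum>n. \<plusminus> 3\<^sup>-\<^sup>n h\<^sub>n / \<parallel>h\<^sub>n\<parallel>\<close> satisfies
  \<open>\<bar>\<langle>v, h\<^sub>n\<rangle>\<bar> \<ge> (4/3)\<^sup>n / 2\<close>.\<close>

lemma weakly_bounded_imp_bounded:
  fixes V :: "'a::complex_hilbert set"
  assumes V: "complex_vector.subspace V" "closed V"
    and KV: "K \<subseteq> V"
    and weak: "\<And>v. v \<in> V \<Longrightarrow> \<exists>B. \<forall>h\<in>K. cmod (cinner v h) \<le> B"
  shows "\<exists>B. \<forall>h\<in>K. norm h \<le> B"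
proof (rule ccontr)
  assume "\<not> ?thesis"
  then have "\<exists>h\<in>K. 4 ^ n < norm h" for n :: nat by (meson not_le)
  then obtain h where hK: "\<And>n. h n \<in> K" and h: "\<And>n::nat. 4 ^ n < norm (h n)" by metis
  define u where "u n = (1/3) ^ n *\<^sub>R sgn (h n)" for n :: nat
  have hpos: "0 < norm (h n)" for n
    by (rule less_trans[OF _ h[of n]]) simp
  have u_norm: "norm (u n) = (1/3) ^ n" for n
    using hpos[of n] by (simp add: u_def norm_sgn)
  have uV: "u n \<in> V" for n
    unfolding u_def sgn_div_norm scaleR_scaleC
    using hK KV by (intro complex_vector.subspace_scale[OF V(1)]) auto
  have u_inner: "cinner (u n) (h n) = of_real ((1/3) ^ n * norm (h n))" for n
    using hpos[of n]
    by (simp add: u_def sgn_div_norm cinner.scaleR_left cinner_self power2_eq_square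
        scaleR_conv_of_real)
  \<comment> \<open>The pairings of \<open>y + u n\<close> and \<open>y - u n\<close> with
    \<open>h n\<close> differ by twice that of \<open>u n\<close>, so for at least one sign the
    pairing is as large as that of \<open>u n\<close> alone.\<close>
  define x where "x = rec_nat 0 (\<lambda>n y.
    if (1/3) ^ n * norm (h n) \<le> cmod (cinner (y + u n) (h n)) then y + u n else y - u n)"
  have x_Suc: "x (Suc n) =
    (if (1/3) ^ n * norm (h n) \<le> cmod (cinner (x n + u n) (h n)) then x n + u n else x n - u n)"
    for n by (simp add: x_def)
  have x0: "x 0 = 0" by (simp add: x_def)
  have xV: "x n \<in> V" for n
  proof (induction n)
    case 0 show ?case using complex_vector.subspace_0[OF V(1)] x0 by simp
  next
    case (Suc n) then show ?case
      unfolding x_Suc using uV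
      by (simp add: complex_vector.subspace_add[OF V(1)] complex_vector.subspace_diff[OF V(1)])
  qed
  have step: "norm (x (Suc n) - x n) = (1/3) ^ n" for n
    by (simp add: x_Suc u_norm)
  have hump: "(1/3) ^ n * norm (h n) \<le> cmod (cinner (x (Suc n)) (h n))" for n
  proof (cases "(1/3) ^ n * norm (h n) \<le> cmod (cinner (x n + u n) (h n))")
    case False
    have "2 * ((1/3) ^ n * norm (h n))
        = cmod (cinner (x n + u n) (h n) - cinner (x n - u n) (h n))"
      by (simp add: cinner.diff_left cinner.add_left u_inner norm_mult norm_power)
    also have "\<dots> \<le> cmod (cinner (x n + u n) (h n)) + cmod (cinner (x n - u n) (h n))"
      by (rule norm_triangle_ineq4)
    finally show ?thesis using False by (simp add: x_Suc)
  qed (simp add: x_Suc)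
  define d where "d n = x (Suc n) - x n" for n
  have geo: "summable (\<lambda>n. (1/3 :: real) ^ n)" by (rule summable_geometric) simp
  have d: "summable d"
    by (rule summable_comparison_test'[OF geo]) (simp add: d_def step)
  have partial: "(\<Sum>k<n. d k) = x n" for n
    by (simp add: d_def sum_lessThan_telescope x0)
  define l where "l = suminf d"
  have lim: "x \<longlonglongrightarrow> l"
    using summable_LIMSEQ[OF d] by (simp add: partial l_def)
  then have "l \<in> V"
    using V(2) xV closed_sequentially by blast
  then obtain B where B: "\<And>n. cmod (cinner l (h n)) \<le> B"
    using weak hK by blast
  \<comment> \<open>All later corrections together have norm at most half of that of
    \<open>u n\<close>, so at least half of the hump at \<open>n\<close> survives in the limit
    \<open>l\<close>.\<close>
  have tail: "norm (l - x (Suc n)) \<le> (1/3) ^ n / 2" for n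
  proof -
    have "l - x (Suc n) = (\<Sum>k. d (k + Suc n))"
      using suminf_minus_initial_segment[OF d, of "Suc n"] unfolding l_def partial by simp
    also have "norm \<dots> \<le> (\<Sum>k. (1/3) ^ (k + Suc n))"
      by (rule norm_suminf_le)
        (simp_all add: d_def step summable_ignore_initial_segment[OF geo, of "Suc n", simplified])
    also have "\<dots> = (\<Sum>k. (1/3) ^ k * (1/3) ^ Suc n)" by (simp only: power_add)
    also have "\<dots> = (\<Sum>k. (1/3) ^ k) * (1/3) ^ Suc n" by (rule suminf_mult2[OF geo, symmetric])
    also have "\<dots> = (1/3) ^ n / 2" by (simp add: suminf_geometric)
    finally show ?thesis .
  qed
  have "(4/3) ^ n \<le> 2 * B" for n
  proof -
    have "cinner (x (Suc n)) (h n) = cinner l (h n) - cinner (l - x (Suc n)) (h n)"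
      by (simp add: cinner.diff_left)
    then have "cmod (cinner (x (Suc n)) (h n))
        \<le> cmod (cinner l (h n)) + cmod (cinner (l - x (Suc n)) (h n))"
      by (metis norm_triangle_ineq4)
    moreover have "cmod (cinner (l - x (Suc n)) (h n)) \<le> (1/3) ^ n / 2 * norm (h n)"
      by (rule order_trans[OF Cauchy_Schwarz_cinner]) (intro mult_right_mono tail norm_ge_zero)
    ultimately have "(1/3) ^ n * norm (h n) \<le> 2 * B"
      using hump[of n] B[of n] by linarith
    moreover have "(4/3 :: real) ^ n = (1/3) ^ n * 4 ^ n"
      by (simp flip: power_mult_distrib)
    moreover have "(1/3 :: real) ^ n * 4 ^ n \<le> (1/3) ^ n * norm (h n)"
      using h[of n] by (intro mult_left_mono) auto
    ultimately show ?thesis by linarith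
  qed
  moreover obtain n where "2 * B < (4/3 :: real) ^ n"
    using real_arch_pow[of "4/3" "2 * B"] by auto
  ultimately show False using not_le by blast
qed


section \<open>Products and the space of square-summable sequences\<close>

text \<open>The library norm on pairs is the Euclidean one, so the norm of \<open>(f, A f)\<close>
  is the graph norm of \<open>f\<close>. General facts on subspaces of a Hilbert space thereby apply
  to the domain of an operator with its graph inner product, although this domain is a set and not a
  type.\<close>

instantiation prod :: (complex_inner, complex_inner) complex_inner
begin

definition "c *\<^sub>C p = (c *\<^sub>C fst p, c *\<^sub>C snd p)"

definition "cinner p q = cinner (fst p) (fst q) + cinner (snd p) (snd q)"

instance
proof
  fix p q r :: "'a \<times> 'b" and a b :: complex and t :: real
  show "t *\<^sub>R p = complex_of_real t *\<^sub>C p"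
    by (simp add: scaleC_prod_def scaleR_prod_def scaleR_scaleC)
  show "a *\<^sub>C (p + q) = a *\<^sub>C p + a *\<^sub>C q" "(a + b) *\<^sub>C p = a *\<^sub>C p + b *\<^sub>C p"
    by (simp_all add: scaleC_prod_def scaleC_add_right scaleC_add_left)
  show "a *\<^sub>C b *\<^sub>C p = (a * b) *\<^sub>C p" "1 *\<^sub>C p = p"
    by (simp_all add: scaleC_prod_def scaleC_scaleC scaleC_one)
  show "cinner p q = cnj (cinner q p)"
    unfolding cinner_prod_def complex_cnj_add
    using cinner_commute[of "fst p" "fst q"] cinner_commute[of "snd p" "snd q"] by simp
  show "cinner (p + q) r = cinner p r + cinner q r"
    by (simp add: cinner_prod_def cinner_add_left)
  show "cinner (a *\<^sub>C p) q = a * cinner p q"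
    by (simp add: cinner_prod_def scaleC_prod_def cinner_scaleC_left distrib_left)
  show "norm p = sqrt (Re (cinner p p))"
    by (simp add: cinner_prod_def cinner_self norm_prod_def)
qed

end

instance prod :: (complex_hilbert, complex_hilbert) complex_hilbert ..

section \<open>Square-summable sequences and the Hilbert space they form\<close>

lemma summable_cmod_sq_add:
  assumes "summable (\<lambda>n. (cmod (c n))\<^sup>2)" "summable (\<lambda>n. (cmod (d n))\<^sup>2)"
  shows "summable (\<lambda>n. (cmod (c n + d n))\<^sup>2)"
proof (rule summable_comparison_test')
  show "summable (\<lambda>n. 2 * (cmod (c n))\<^sup>2 + 2 * (cmod (d n))\<^sup>2)"
    using assms by (intro summable_add summable_mult)
  fix n :: nat assume "0 \<le> n"
  have "(cmod (c n + d n))\<^sup>2 \<le> (cmod (c n) + cmod (d n))\<^sup>2"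
    by (intro power_mono norm_triangle_ineq) simp
  moreover have "0 \<le> (cmod (c n) - cmod (d n))\<^sup>2" by simp
  ultimately show "norm ((cmod (c n + d n))\<^sup>2) \<le> 2 * (cmod (c n))\<^sup>2 + 2 * (cmod (d n))\<^sup>2"
    by (simp add: power2_sum power2_diff)
qed

lemma summable_mult_cnj:
  assumes "summable (\<lambda>n. (cmod (c n))\<^sup>2)" "summable (\<lambda>n. (cmod (d n))\<^sup>2)"
  shows "summable (\<lambda>n. c n * cnj (d n))"
proof (rule summable_comparison_test')
  show "summable (\<lambda>n. (cmod (c n))\<^sup>2 + (cmod (d n))\<^sup>2)"
    using assms by (rule summable_add)
  fix n :: nat assume "0 \<le> n"
  have "0 \<le> (cmod (c n) - cmod (d n))\<^sup>2" by simp
  moreover have "0 \<le> cmod (c n) * cmod (d n)" by simp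
  ultimately show "norm (c n * cnj (d n)) \<le> (cmod (c n))\<^sup>2 + (cmod (d n))\<^sup>2"
    unfolding power2_diff norm_mult complex_mod_cnj by linarith
qed

lemma ell2_norm_nonneg: "c \<in> ell2 \<Longrightarrow> 0 \<le> ell2_norm c"
  by (simp add: ell2_norm_def ell2_def suminf_nonneg)

text \<open>Bounds on finite sections suffice: the triangle inequality, completeness and the Bessel
  estimates are all proved on finite sums and transferred by this rule.\<close>

lemma ell2_normI:
  assumes "\<And>N. (\<Sum>n<N. (cmod (c n))\<^sup>2) \<le> B\<^sup>2" and "0 \<le> B"
  shows "c \<in> ell2" "ell2_norm c \<le> B"
proof -
  have s: "summable (\<lambda>n. (cmod (c n))\<^sup>2)"
    by (rule bounded_imp_summable[of _ "B\<^sup>2"])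
      (simp, use assms(1)[of "Suc _"] lessThan_Suc_atMost in metis)
  then show "c \<in> ell2" by (simp add: ell2_def)
  have "(\<Sum>n. (cmod (c n))\<^sup>2) \<le> B\<^sup>2"
    using suminf_le_const[OF s assms(1)] .
  then show "ell2_norm c \<le> B"
    unfolding ell2_norm_def using assms(2) by (simp add: real_le_lsqrt suminf_nonneg[OF s])
qed

lemma sum_le_ell2_norm:
  assumes "c \<in> ell2" and "finite F"
  shows "(\<Sum>n\<in>F. (cmod (c n))\<^sup>2) \<le> (ell2_norm c)\<^sup>2"
  using assms by (simp add: ell2_norm_def ell2_def suminf_nonneg sum_le_suminf)

text \<open>The Riesz representation is stated for a type class; as a type, \<open>ell2\<close>
  becomes an instance, and the representation can be applied to the range of the analysis
  operator.\<close>

typedef l2 = ell2 morphisms coord Abs_l2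
  by (rule exI[of _ "\<lambda>_. 0"]) (simp add: ell2_def)

lemma summable_coord: "summable (\<lambda>n. (cmod (coord x n))\<^sup>2)"
  using coord[of x] by (simp add: ell2_def)

lemma l2_eqI: "(\<And>n. coord x n = coord y n) \<Longrightarrow> x = y"
  using coord_inject by blast

instantiation l2 :: complex_inner
begin

definition "0 = Abs_l2 (\<lambda>_. 0)"
definition "x + y = Abs_l2 (\<lambda>n. coord x n + coord y n)"
definition "- x = Abs_l2 (\<lambda>n. - coord x n)"
definition "x - y = Abs_l2 (\<lambda>n. coord x n - coord y n)"
definition "c *\<^sub>C x = Abs_l2 (\<lambda>n. c * coord x n)"
definition "r *\<^sub>R x = Abs_l2 (\<lambda>n. complex_of_real r * coord x n)"
definition "norm x = ell2_norm (coord x)"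
definition "sgn x = inverse (norm x) *\<^sub>R x" for x :: l2
definition "dist x y = norm (x - y)" for x y :: l2
definition "(uniformity :: (l2 \<times> l2) filter) = (INF e\<in>{0<..}. principal {(x, y). dist x y < e})"
definition "open U \<longleftrightarrow> (\<forall>x\<in>U. eventually (\<lambda>(x', y). x' = x \<longrightarrow> y \<in> U) uniformity)"
  for U :: "l2 set"
definition "cinner x y = (\<Sum>n. coord x n * cnj (coord y n))"

lemma coord_zero: "coord 0 = (\<lambda>_. 0)"
  unfolding zero_l2_def by (intro Abs_l2_inverse) (simp add: ell2_def)

lemma coord_add: "coord (x + y) = (\<lambda>n. coord x n + coord y n)"
  unfolding plus_l2_def
  by (intro Abs_l2_inverse) (simp add: ell2_def summable_cmod_sq_add summable_coord)

lemma coord_scaleC: "coord (c *\<^sub>C x) = (\<lambda>n. c * coord x n)"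
  unfolding scaleC_l2_def
  by (intro Abs_l2_inverse)
    (simp add: ell2_def norm_mult power_mult_distrib summable_mult summable_coord)

lemma coord_scaleR: "coord (r *\<^sub>R x) = (\<lambda>n. complex_of_real r * coord x n)"
  using coord_scaleC[of "of_real r"] unfolding scaleC_l2_def scaleR_l2_def .

lemma coord_minus: "coord (- x) = (\<lambda>n. - coord x n)"
  using coord_scaleC[of "- 1"] unfolding scaleC_l2_def uminus_l2_def by simp

lemma coord_diff: "coord (x - y) = (\<lambda>n. coord x n - coord y n)"
  using coord_add[of x "- y"] unfolding plus_l2_def minus_l2_def by (simp add: coord_minus)

lemmas coord_simps = coord_zero coord_add coord_scaleC coord_scaleR coord_minus coord_diff

lemma norm_l2_sq: "(norm x)\<^sup>2 = (\<Sum>n. (cmod (coord x n))\<^sup>2)" for x :: l2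
  by (simp add: norm_l2_def ell2_norm_def suminf_nonneg summable_coord)

lemma norm_l2_triangle: "norm (x + y) \<le> norm x + norm y" for x y :: l2
  unfolding norm_l2_def[of "x + y"]
proof (rule ell2_normI)
  have pos: "0 \<le> norm x" "0 \<le> norm y"
    using ell2_norm_nonneg coord by (auto simp: norm_l2_def)
  then show "0 \<le> norm x + norm y" by simp
  fix N
  have "L2_set (\<lambda>n. cmod (coord (x + y) n)) {..<N}
      \<le> L2_set (\<lambda>n. cmod (coord x n) + cmod (coord y n)) {..<N}"
    by (intro L2_set_mono) (simp_all add: coord_add norm_triangle_ineq)
  also have "\<dots> \<le> L2_set (\<lambda>n. cmod (coord x n)) {..<N} + L2_set (\<lambda>n. cmod (coord y n)) {..<N}"
    by (rule L2_set_triangle_ineq)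
  also have "\<dots> \<le> norm x + norm y"
    unfolding L2_set_def norm_l2_def using sum_le_ell2_norm[OF coord] ell2_norm_nonneg[OF coord]
    by (intro add_mono real_le_lsqrt) (auto intro: sum_nonneg)
  finally have "(L2_set (\<lambda>n. cmod (coord (x + y) n)) {..<N})\<^sup>2 \<le> (norm x + norm y)\<^sup>2"
    by (intro power_mono) (auto simp: L2_set_nonneg)
  then show "(\<Sum>n<N. (cmod (coord (x + y) n))\<^sup>2) \<le> (norm x + norm y)\<^sup>2"
    by (simp add: L2_set_def sum_nonneg)
qed

instance
proof
  fix x y z :: l2 and a b :: complex and r s :: real and U :: "l2 set"
  show "x + y + z = x + (y + z)" "x + y = y + x" "0 + x = x" "- x + x = 0" "x - y = x + - y"
    "r *\<^sub>R (x + y) = r *\<^sub>R x + r *\<^sub>R y" "(r + s) *\<^sub>R x = r *\<^sub>R x + s *\<^sub>R x"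
    "r *\<^sub>R s *\<^sub>R x = (r * s) *\<^sub>R x" "1 *\<^sub>R x = x"
    "r *\<^sub>R x = complex_of_real r *\<^sub>C x" "a *\<^sub>C (x + y) = a *\<^sub>C x + a *\<^sub>C y"
    "(a + b) *\<^sub>C x = a *\<^sub>C x + b *\<^sub>C x" "a *\<^sub>C b *\<^sub>C x = (a * b) *\<^sub>C x" "1 *\<^sub>C x = x"
    by (rule l2_eqI; simp add: coord_simps algebra_simps)+
  show "dist x y = norm (x - y)" "sgn x = inverse (norm x) *\<^sub>R x"
    "(uniformity :: (l2 \<times> l2) filter) = (INF e\<in>{0<..}. principal {(x, y). dist x y < e})"
    "open U \<longleftrightarrow> (\<forall>x\<in>U. eventually (\<lambda>(x', y). x' = x \<longrightarrow> y \<in> U) uniformity)"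
    by (rule dist_l2_def sgn_l2_def uniformity_l2_def open_l2_def)+
  show "norm (x + y) \<le> norm x + norm y" by (rule norm_l2_triangle)
  show "norm x = 0 \<longleftrightarrow> x = 0"
  proof
    assume "norm x = 0"
    then have "(\<Sum>n. (cmod (coord x n))\<^sup>2) = 0" using norm_l2_sq[of x] by simp
    then have "\<forall>n. (cmod (coord x n))\<^sup>2 = 0"
      by (subst (asm) suminf_eq_zero_iff[OF summable_coord]) auto
    then show "x = 0" by (intro l2_eqI) (simp add: coord_zero)
  qed (simp add: norm_l2_def coord_zero ell2_norm_def)
  show "norm (r *\<^sub>R x) = \<bar>r\<bar> * norm x"
    by (simp add: norm_l2_def coord_scaleR ell2_norm_def norm_mult power_mult_distrib
        suminf_mult summable_coord real_sqrt_mult)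
  show "cinner x y = cnj (cinner y x)"
  proof -
    have "(\<lambda>n. cnj (coord y n * cnj (coord x n))) sums cnj (cinner y x)"
      unfolding sums_cnj cinner_l2_def by (intro summable_sums summable_mult_cnj summable_coord)
    then show ?thesis
      unfolding cinner_l2_def by (intro sums_unique[symmetric]) (simp add: mult.commute)
  qed
  show "cinner (x + y) z = cinner x z + cinner y z"
    unfolding cinner_l2_def coord_add distrib_right
    by (intro suminf_add[symmetric] summable_mult_cnj summable_coord)
  show "cinner (a *\<^sub>C x) y = a * cinner x y"
    unfolding cinner_l2_def coord_scaleC mult.assoc
    by (intro suminf_mult summable_mult_cnj summable_coord)
  show "norm x = sqrt (Re (cinner x x))"
    unfolding cinner_l2_def complex_norm_square[symmetric] norm_l2_def ell2_norm_def
      suminf_of_real[OF summable_coord, symmetric] Re_complex_of_real ..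
qed

end

lemma cmod_coord_le: "cmod (coord x n) \<le> norm x"
proof -
  have "(\<Sum>k\<in>{n}. (cmod (coord x k))\<^sup>2) \<le> (norm x)\<^sup>2"
    unfolding norm_l2_def by (intro sum_le_ell2_norm coord) simp
  then have "(cmod (coord x n))\<^sup>2 \<le> (norm x)\<^sup>2" by simp
  then show ?thesis by (rule power2_le_imp_le) simp
qed

text \<open>Each coordinate map is contractive, so a Cauchy sequence converges coordinatewise. The
  Cauchy estimate on the first \<open>N\<close> coordinates survives the limit in \<open>q\<close>
  with a bound independent of \<open>N\<close>, so the convergence holds in norm.\<close>

instance l2 :: complex_hilbert
proof
  fix X :: "nat \<Rightarrow> l2" assume X: "Cauchy X"
  have "Cauchy (\<lambda>k. coord (X k) n)" for n
  proof (rule metric_CauchyI)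
    fix e :: real assume "0 < e"
    then obtain M where M: "\<And>p q. M \<le> p \<Longrightarrow> M \<le> q \<Longrightarrow> dist (X p) (X q) < e"
      using metric_CauchyD[OF X] by metis
    have "dist (coord (X p) n) (coord (X q) n) \<le> dist (X p) (X q)" for p q
      using cmod_coord_le[of "X p - X q" n] by (simp add: dist_norm coord_diff)
    with M show "\<exists>M. \<forall>p\<ge>M. \<forall>q\<ge>M. dist (coord (X p) n) (coord (X q) n) < e"
      by (meson le_less_trans)
  qed
  then have "\<forall>n. \<exists>l. (\<lambda>k. coord (X k) n) \<longlonglongrightarrow> l"
    by (simp add: Cauchy_convergent_iff convergent_def)
  then obtain l where l: "\<And>n. (\<lambda>k. coord (X k) n) \<longlonglongrightarrow> l n" by metis
  have bound: "(\<Sum>n<N. (cmod (coord (X p) n - l n))\<^sup>2) \<le> e\<^sup>2"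
    if "\<And>p q. M \<le> p \<Longrightarrow> M \<le> q \<Longrightarrow> dist (X p) (X q) < e" "M \<le> p" for e M N p
  proof (rule LIMSEQ_le_const2)
    show "(\<lambda>q. \<Sum>n<N. (cmod (coord (X p) n - coord (X q) n))\<^sup>2)
        \<longlonglongrightarrow> (\<Sum>n<N. (cmod (coord (X p) n - l n))\<^sup>2)"
      by (intro tendsto_intros l)
    have "(\<Sum>n<N. (cmod (coord (X p) n - coord (X q) n))\<^sup>2) \<le> e\<^sup>2" if "M \<le> q" for q
    proof -
      have "(\<Sum>n<N. (cmod (coord (X p - X q) n))\<^sup>2) \<le> (norm (X p - X q))\<^sup>2"
        unfolding norm_l2_def by (intro sum_le_ell2_norm coord) simp
      also have "\<dots> \<le> e\<^sup>2"
        using \<open>\<And>p q. M \<le> p \<Longrightarrow> M \<le> q \<Longrightarrow> dist (X p) (X q) < e\<close>[OF \<open>M \<le> p\<close> that]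
        by (intro power_mono) (auto simp: dist_norm)
      finally show ?thesis by (simp add: coord_diff)
    qed
    then show "\<exists>K. \<forall>q\<ge>K. (\<Sum>n<N. (cmod (coord (X p) n - coord (X q) n))\<^sup>2) \<le> e\<^sup>2" by blast
  qed
  have diff: "(\<lambda>n. coord (X p) n - l n) \<in> ell2 \<and> ell2_norm (\<lambda>n. coord (X p) n - l n) \<le> e"
    if "\<And>p q. M \<le> p \<Longrightarrow> M \<le> q \<Longrightarrow> dist (X p) (X q) < e" "M \<le> p" "0 < e" for e M p
    using ell2_normI[OF bound[OF that(1,2)]] that(3) by auto
  obtain M where "\<And>p q. M \<le> p \<Longrightarrow> M \<le> q \<Longrightarrow> dist (X p) (X q) < 1"
    using metric_CauchyD[OF X, of 1] by auto
  from diff[OF this order_refl zero_less_one] have "(\<lambda>n. coord (X M) n - l n) \<in> ell2"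
    by blast
  \<comment> \<open>The limit is square-summable because it is \<open>X M\<close> minus the
    square-summable sequence just found.\<close>
  then have "coord (X M - Abs_l2 (\<lambda>n. coord (X M) n - l n)) = l"
    by (simp add: coord_diff Abs_l2_inverse)
  then obtain L where L: "coord L = l" by blast
  have "X \<longlonglongrightarrow> L"
  proof (rule metric_LIMSEQ_I)
    fix e :: real assume "0 < e"
    then have e: "0 < e / 2" "e / 2 < e" by simp_all
    obtain M where M: "\<And>p q. M \<le> p \<Longrightarrow> M \<le> q \<Longrightarrow> dist (X p) (X q) < e / 2"
      using metric_CauchyD[OF X e(1)] by auto
    have "dist (X p) L < e" if "M \<le> p" for p
    proof -
      have "dist (X p) L = ell2_norm (\<lambda>n. coord (X p) n - l n)"
        by (simp add: dist_norm norm_l2_def coord_diff L)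
      also have "\<dots> \<le> e / 2" using diff[OF M that e(1)] by blast
      finally show ?thesis using e(2) by (rule le_less_trans)
    qed
    then show "\<exists>M. \<forall>p\<ge>M. dist (X p) L < e" by blast
  qed
  then show "convergent X" by (auto simp: convergent_def)
qed


section \<open>Bessel sequences and the synthesis operator\<close>

lemma bessel_sequence_UNIV_iff:
  "bessel_sequence UNIV cinner g \<longleftrightarrow>
    (\<exists>\<beta>>0. \<forall>f. summable (\<lambda>n. (cmod (cinner f (g n)))\<^sup>2) \<and>
       (\<Sum>n. (cmod (cinner f (g n)))\<^sup>2) \<le> \<beta> * (norm f)\<^sup>2)"
  for g :: "nat \<Rightarrow> 'a::complex_inner"
  by (simp add: bessel_sequence_def norm_eq_sqrt_cinner[symmetric])

text \<open>Duality: expanding one factor of \<open>cinner s s\<close> for the finite sum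
  \<open>s\<close> gives the coefficients \<open>cinner s (g n)\<close>, whose squares sum to at
  most \<open>\<beta> * (norm s)\<^sup>2\<close>; Cauchy-Schwarz and cancelling
  \<open>(norm s)\<^sup>2\<close> finish. General finite index sets cover both the initial segments
  and the blocks of the Cauchy criterion.\<close>

lemma bessel_sum_bound:
  fixes g :: "nat \<Rightarrow> 'a::complex_inner"
  assumes bessel: "\<And>f. summable (\<lambda>n. (cmod (cinner f (g n)))\<^sup>2)"
      "\<And>f. (\<Sum>n. (cmod (cinner f (g n)))\<^sup>2) \<le> \<beta> * (norm f)\<^sup>2"
    and "0 \<le> \<beta>" "finite F"
  shows "(norm (\<Sum>n\<in>F. c n *\<^sub>C g n))\<^sup>2 \<le> \<beta> * (\<Sum>n\<in>F. (cmod (c n))\<^sup>2)"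
proof -
  define s where "s = (\<Sum>n\<in>F. c n *\<^sub>C g n)"
  define q where "q = (\<Sum>n\<in>F. (cmod (c n))\<^sup>2)"
  have q: "0 \<le> q" by (simp add: q_def sum_nonneg)
  have "cinner s s = (\<Sum>n\<in>F. c n * cinner (g n) s)"
    by (subst (1) s_def) (simp add: cinner.sum_left cinner_scaleC_left)
  then have "(norm s)\<^sup>2 = cmod (\<Sum>n\<in>F. c n * cinner (g n) s)"
    by (metis cinner_self norm_of_real abs_of_nonneg zero_le_power2)
  also have "\<dots> \<le> (\<Sum>n\<in>F. cmod (c n) * cmod (cinner s (g n)))"
    using cinner_commute[of _ s]
    by (intro order_trans[OF norm_sum] sum_mono) (metis complex_mod_cnj norm_mult order_refl)
  finally have "((norm s)\<^sup>2)\<^sup>2 \<le> (\<Sum>n\<in>F. cmod (c n) * cmod (cinner s (g n)))\<^sup>2"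
    by (intro power_mono) auto
  also have "\<dots> \<le> q * (\<Sum>n\<in>F. (cmod (cinner s (g n)))\<^sup>2)"
    unfolding q_def by (rule Cauchy_Schwarz_ineq_sum)
  also have "\<dots> \<le> q * (\<beta> * (norm s)\<^sup>2)"
    by (intro mult_left_mono q order_trans[OF sum_le_suminf bessel(2)] bessel(1) assms(4)) simp
  finally have "(norm s)\<^sup>2 * (norm s)\<^sup>2 \<le> (\<beta> * q) * (norm s)\<^sup>2"
    by (simp add: power2_eq_square mult_ac)
  then have "s \<noteq> 0 \<Longrightarrow> (norm s)\<^sup>2 \<le> \<beta> * q"
    by (rule mult_right_le_imp_le) simp
  then show ?thesis
    unfolding s_def[symmetric] q_def[symmetric] using q assms(3) by (cases "s = 0") auto
qed

text \<open>By \<open>bessel_sum_bound\<close> the blocks of the series are controlled by those of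
  the squared coefficients, so the Cauchy criterion carries over.\<close>

lemma summable_synthesis:
  fixes g :: "nat \<Rightarrow> 'a::complex_hilbert"
  assumes "bessel_sequence UNIV cinner g" and c: "c \<in> ell2"
  shows "summable (\<lambda>n. c n *\<^sub>C g n)"
proof -
  obtain \<beta> where \<beta>: "0 < \<beta>"
    and bessel: "\<And>f. summable (\<lambda>n. (cmod (cinner f (g n)))\<^sup>2)"
      "\<And>f. (\<Sum>n. (cmod (cinner f (g n)))\<^sup>2) \<le> \<beta> * (norm f)\<^sup>2"
    using assms(1) unfolding bessel_sequence_UNIV_iff by blast
  show ?thesis
    unfolding summable_Cauchy
  proof (intro allI impI)
    fix e :: real assume e: "0 < e"
    have "0 < e\<^sup>2 / \<beta>" using e \<beta> by simp
    then obtain N where N: "\<And>m n. N \<le> m \<Longrightarrow> norm (\<Sum>k=m..<n. (cmod (c k))\<^sup>2) < e\<^sup>2 / \<beta>"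
      using c unfolding ell2_def mem_Collect_eq summable_Cauchy by blast
    have "norm (\<Sum>k=m..<n. c k *\<^sub>C g k) < e" if "N \<le> m" for m n
    proof (rule power2_less_imp_less)
      have "(norm (\<Sum>k=m..<n. c k *\<^sub>C g k))\<^sup>2 \<le> \<beta> * (\<Sum>k=m..<n. (cmod (c k))\<^sup>2)"
        using \<beta> by (intro bessel_sum_bound bessel) auto
      also have "\<dots> < \<beta> * (e\<^sup>2 / \<beta>)"
        using N[OF that, of n] \<beta> by (intro mult_strict_left_mono) (auto simp: sum_nonneg)
      finally show "(norm (\<Sum>k=m..<n. c k *\<^sub>C g k))\<^sup>2 < e\<^sup>2" using \<beta> by simp
    qed (use e in simp)
    then show "\<exists>N. \<forall>m\<ge>N. \<forall>n. norm (\<Sum>k=m..<n. c k *\<^sub>C g k) < e" by blast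
  qed
qed

lemma bessel_sequence_iff_synthesis_bounded:
  fixes g :: "nat \<Rightarrow> 'a::complex_hilbert"
  shows "bessel_sequence UNIV cinner g \<longleftrightarrow> synthesis_bounded_everywhere_defined g"
proof
  assume B: "bessel_sequence UNIV cinner g"
  then obtain \<beta> where \<beta>: "0 < \<beta>"
    and bessel: "\<And>f. summable (\<lambda>n. (cmod (cinner f (g n)))\<^sup>2)"
      "\<And>f. (\<Sum>n. (cmod (cinner f (g n)))\<^sup>2) \<le> \<beta> * (norm f)\<^sup>2"
    unfolding bessel_sequence_UNIV_iff by blast
  have dom: "synthesis_domain g = ell2"
    unfolding synthesis_domain_def using summable_synthesis[OF B] by auto
  have "norm (synthesis g c) \<le> sqrt \<beta> * ell2_norm c" if c: "c \<in> ell2" for c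
  proof (rule LIMSEQ_le_const2)
    show "(\<lambda>N. norm (\<Sum>n<N. c n *\<^sub>C g n)) \<longlonglongrightarrow> norm (synthesis g c)"
      unfolding synthesis_def by (intro tendsto_norm summable_LIMSEQ summable_synthesis B c)
    have "norm (\<Sum>n<N. c n *\<^sub>C g n) \<le> sqrt \<beta> * ell2_norm c" for N
    proof (rule power2_le_imp_le)
      have "(norm (\<Sum>n<N. c n *\<^sub>C g n))\<^sup>2 \<le> \<beta> * (\<Sum>n<N. (cmod (c n))\<^sup>2)"
        using \<beta> by (intro bessel_sum_bound bessel) auto
      also have "\<dots> \<le> \<beta> * (ell2_norm c)\<^sup>2"
        using \<beta> c by (intro mult_left_mono sum_le_ell2_norm) auto
      finally show "(norm (\<Sum>n<N. c n *\<^sub>C g n))\<^sup>2 \<le> (sqrt \<beta> * ell2_norm c)\<^sup>2"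
        using \<beta> by (simp add: power_mult_distrib)
    qed (use \<beta> ell2_norm_nonneg[OF c] in simp)
    then show "\<exists>K. \<forall>N\<ge>K. norm (\<Sum>n<N. c n *\<^sub>C g n) \<le> sqrt \<beta> * ell2_norm c" by blast
  qed
  then show "synthesis_bounded_everywhere_defined g"
    unfolding synthesis_bounded_everywhere_defined_def dom by blast
next
  assume "synthesis_bounded_everywhere_defined g"
  then obtain C where C: "\<And>c. c \<in> ell2 \<Longrightarrow> norm (synthesis g c) \<le> C * ell2_norm c"
    unfolding synthesis_bounded_everywhere_defined_def by auto
  have partial: "(\<Sum>n<N. (cmod (cinner f (g n)))\<^sup>2) \<le> (\<bar>C\<bar> * norm f)\<^sup>2" for f N
  proof -
    \<comment> \<open>Truncated analysis coefficients of \<open>f\<close> are an admissible input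
      for \<open>D\<close>. Their synthesis pairs with \<open>f\<close> to \<open>q\<close>, while
      their norm is \<open>sqrt q\<close>, so boundedness gives
      \<open>sqrt q \<le> \<bar>C\<bar> * norm f\<close>.\<close>
    define c where "c n = (if n < N then cinner f (g n) else 0)" for n
    define q where "q = (\<Sum>n<N. (cmod (cinner f (g n)))\<^sup>2)"
    have sq: "(\<lambda>n. (cmod (c n))\<^sup>2) sums q"
      unfolding q_def using sums_If_finite_set[of "{..<N}" "\<lambda>n. (cmod (cinner f (g n)))\<^sup>2"]
      by (simp add: c_def if_distrib[of cmod] if_distrib[of "\<lambda>x. x ^ _"] cong: if_cong)
    then have c: "c \<in> ell2" and cn: "ell2_norm c = sqrt q"
      by (auto simp: ell2_def ell2_norm_def sums_iff)
    have q: "0 \<le> q" by (simp add: q_def sum_nonneg)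
    have synth: "synthesis g c = (\<Sum>n<N. c n *\<^sub>C g n)"
      unfolding synthesis_def
      by (rule suminf_finite) (auto simp: c_def)
    have "cinner (synthesis g c) f = of_real q"
      unfolding synth q_def cinner.sum_left cinner_scaleC_left of_real_sum
      using cinner_commute[of _ f]
      by (intro sum.cong) (auto simp: c_def complex_norm_square simp del: of_real_power)
    then have "q = cmod (cinner (synthesis g c) f)" using q by simp
    also have "\<dots> \<le> norm (synthesis g c) * norm f" by (rule Cauchy_Schwarz_cinner)
    also have "\<dots> \<le> (C * sqrt q) * norm f"
      using C[OF c] by (intro mult_right_mono) (auto simp: cn)
    also have "\<dots> \<le> (\<bar>C\<bar> * sqrt q) * norm f"
      using q by (intro mult_right_mono) auto
    finally have "sqrt q * sqrt q \<le> (\<bar>C\<bar> * norm f) * sqrt q"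
      using q by (simp add: mult_ac)
    then have "q \<noteq> 0 \<Longrightarrow> sqrt q \<le> \<bar>C\<bar> * norm f"
      using q by (intro mult_right_le_imp_le[of "sqrt q" "sqrt q"]) auto
    then have "sqrt q \<le> \<bar>C\<bar> * norm f" by (cases "q = 0") auto
    then have "(sqrt q)\<^sup>2 \<le> (\<bar>C\<bar> * norm f)\<^sup>2"
      using q by (intro power_mono) auto
    then show ?thesis using q by (simp add: q_def)
  qed
  \<comment> \<open>The summand 1 makes the Bessel constant positive even when \<open>C\<close> is
    0.\<close>
  have "summable (\<lambda>n. (cmod (cinner f (g n)))\<^sup>2)"
    "(\<Sum>n. (cmod (cinner f (g n)))\<^sup>2) \<le> (C\<^sup>2 + 1) * (norm f)\<^sup>2" for f
  proof -
    have in_ell2: "(\<lambda>n. cinner f (g n)) \<in> ell2"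
      by (rule ell2_normI(1)[OF partial]) simp
    then show s: "summable (\<lambda>n. (cmod (cinner f (g n)))\<^sup>2)" by (simp add: ell2_def)
    have "(\<Sum>n. (cmod (cinner f (g n)))\<^sup>2) \<le> (\<bar>C\<bar> * norm f)\<^sup>2"
      by (rule suminf_le_const[OF s partial])
    also have "\<dots> \<le> (C\<^sup>2 + 1) * (norm f)\<^sup>2" by (simp add: power_mult_distrib distrib_right)
    finally show "(\<Sum>n. (cmod (cinner f (g n)))\<^sup>2) \<le> (C\<^sup>2 + 1) * (norm f)\<^sup>2" .
  qed
  then show "bessel_sequence UNIV cinner g"
    unfolding bessel_sequence_UNIV_iff by (intro exI[of _ "C\<^sup>2 + 1"]) (auto simp: add_nonneg_pos)
qed

text \<open>The adjoint \<open>D\<^sup>*\<close> of the synthesis operator, as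
  \<open>synthesis_adjoint\<close> confirms. \<open>Abs_l2\<close> is unspecified outside
  \<open>ell2\<close>, so the facts on \<open>analysis\<close> assume a Bessel sequence.\<close>

definition analysis :: "(nat \<Rightarrow> 'a::complex_inner) \<Rightarrow> 'a \<Rightarrow> l2" where
  "analysis g f = Abs_l2 (\<lambda>n. cinner f (g n))"

lemma coord_analysis:
  assumes "bessel_sequence UNIV cinner g"
  shows "coord (analysis g f) = (\<lambda>n. cinner f (g n))"
  using assms unfolding analysis_def
  by (intro Abs_l2_inverse) (auto simp: bessel_sequence_UNIV_iff ell2_def)

lemma norm_analysis_sq:
  assumes "bessel_sequence UNIV cinner g"
  shows "(norm (analysis g f))\<^sup>2 = (\<Sum>n. (cmod (cinner f (g n)))\<^sup>2)"
  by (simp add: norm_l2_sq coord_analysis[OF assms])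

lemma analysis_add:
  assumes "bessel_sequence UNIV cinner g"
  shows "analysis g (f + h) = analysis g f + analysis g h"
  by (rule l2_eqI) (simp add: coord_add coord_analysis[OF assms] cinner_add_left)

lemma analysis_scaleC:
  assumes "bessel_sequence UNIV cinner g"
  shows "analysis g (c *\<^sub>C f) = c *\<^sub>C analysis g f"
  by (rule l2_eqI) (simp add: coord_scaleC coord_analysis[OF assms] cinner_scaleC_left)

lemma analysis_diff:
  assumes "bessel_sequence UNIV cinner g"
  shows "analysis g (f - h) = analysis g f - analysis g h"
  by (rule l2_eqI) (simp add: coord_diff coord_analysis[OF assms] cinner.diff_left)

lemma synthesis_adjoint:
  fixes g :: "nat \<Rightarrow> 'a::complex_hilbert"
  assumes "bessel_sequence UNIV cinner g"
  shows "cinner f (synthesis g (coord a)) = cinner (analysis g f) a"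
proof -
  have "(\<lambda>n. cinner f (coord a n *\<^sub>C g n)) sums cinner f (synthesis g (coord a))"
    unfolding synthesis_def
    by (intro bounded_linear.sums[OF cinner.bounded_linear_right] summable_sums
        summable_synthesis assms coord)
  then show ?thesis
    by (simp add: cinner_l2_def coord_analysis[OF assms] cinner_scaleC_right sums_iff mult.commute)
qed


section \<open>The graph of a closed operator\<close>

lemma graph_norm_eq: "graph_norm A f = norm (f, A f)"
  by (simp add: graph_norm_def graph_inner_def norm_eq_sqrt_cinner cinner_prod_def)

lemma graph_inner_eq: "graph_inner A f h = cinner (f, A f) (h, A h)"
  by (simp add: graph_inner_def cinner_prod_def)

locale closed_operator =
  fixes S :: "'a::complex_hilbert set" and A :: "'a \<Rightarrow> 'a"
  assumes closed_operator: "closed_densely_defined_operator S A"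
begin

definition G :: "('a \<times> 'a) set" where "G = {(f, A f) |f. f \<in> S}"

lemma subspace_S: "complex_vector.subspace S"
  and A_add: "f \<in> S \<Longrightarrow> h \<in> S \<Longrightarrow> A (f + h) = A f + A h"
  and A_scaleC: "f \<in> S \<Longrightarrow> A (c *\<^sub>C f) = c *\<^sub>C A f"
  and closed_G: "closed G"
  using closed_operator unfolding closed_densely_defined_operator_def G_def by auto

lemma subspace_G: "complex_vector.subspace G"
proof -
  have "A 0 = 0"
    using A_scaleC[OF complex_vector.subspace_0[OF subspace_S], of 0] by simp
  then show ?thesis
    unfolding complex_vector.subspace_def G_def zero_prod_def
    using complex_vector.subspace_0[OF subspace_S] complex_vector.subspace_add[OF subspace_S]
      complex_vector.subspace_scale[OF subspace_S]
    by (auto simp: A_add A_scaleC scaleC_prod_def)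
qed

text \<open>The functional is read on the graph through the first component. Since the graph is
  closed, the representing pair belongs to it and has the form \<open>(k, A k)\<close>.\<close>

lemma riesz_graph:
  assumes "\<And>f h. f \<in> S \<Longrightarrow> h \<in> S \<Longrightarrow> \<phi> (f + h) = \<phi> f + \<phi> h"
    and "\<And>c f. f \<in> S \<Longrightarrow> \<phi> (c *\<^sub>C f) = c * \<phi> f"
    and "\<And>f. f \<in> S \<Longrightarrow> cmod (\<phi> f) \<le> C * graph_norm A f"
  shows "\<exists>k\<in>S. \<forall>f\<in>S. \<phi> f = graph_inner A f k"
proof -
  have "cmod (\<phi> f) \<le> \<bar>C\<bar> * norm (f, A f)" if "f \<in> S" for f
    using assms(3)[OF that] unfolding graph_norm_eq
    by (rule order_trans) (intro mult_right_mono, auto)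
  note bound = this
  show ?thesis
  proof (rule riesz_representation[OF subspace_G, of "\<lambda>q. \<phi> (fst q)" "\<bar>C\<bar>"])
    fix p assume p: "p \<in> closure G" "\<And>q. q \<in> G \<Longrightarrow> \<phi> (fst q) = cinner q p"
    then obtain k where k: "k \<in> S" "p = (k, A k)"
      using closed_G by (auto simp: G_def)
    have "\<phi> f = graph_inner A f k" if "f \<in> S" for f
      using p(2)[of "(f, A f)"] that by (auto simp: G_def graph_inner_eq k(2))
    with k(1) show ?thesis by blast
  qed (use assms(1,2) bound in \<open>auto simp: G_def scaleC_prod_def\<close>)
qed

text \<open>The functional sending \<open>u\<close> to \<open>cinner (A u) f\<close> is bounded in
  the graph norm by \<open>norm f\<close>, because \<open>norm (A u)\<close> is at most the graph
  norm of \<open>u\<close>. Riesz gives existence; uniqueness, tested on the whole graph, makes the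
  description by \<open>THE\<close> meaningful.\<close>

lemma graph_adjoint:
  "graph_adjoint S A f \<in> S"
  "u \<in> S \<Longrightarrow> cinner (A u) f = graph_inner A u (graph_adjoint S A f)"
proof -
  have bound: "cmod (cinner (A u) f) \<le> norm f * graph_norm A u" for u
  proof -
    have "norm (A u) \<le> graph_norm A u"
      unfolding graph_norm_eq by (rule norm_snd_le)
    then have "norm (A u) * norm f \<le> norm f * graph_norm A u"
      by (simp add: mult.commute mult_left_mono)
    with Cauchy_Schwarz_cinner show ?thesis by (rule order_trans)
  qed
  have "\<exists>k\<in>S. \<forall>u\<in>S. cinner (A u) f = graph_inner A u k"
    by (rule riesz_graph[OF _ _ bound])
      (simp_all add: A_add A_scaleC cinner_add_left cinner_scaleC_left)
  then obtain k where k: "k \<in> S" "\<And>u. u \<in> S \<Longrightarrow> cinner (A u) f = graph_inner A u k"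
    by blast
  have "\<exists>!h. h \<in> S \<and> (\<forall>u\<in>S. cinner (A u) f = graph_inner A u h)"
  proof (rule ex1I[of _ k])
    fix h assume h: "h \<in> S \<and> (\<forall>u\<in>S. cinner (A u) f = graph_inner A u h)"
    have "(h, A h) = (k, A k)"
    proof (rule cinner_eq_closure_imp_eq[OF subspace_G])
      show "(h, A h) \<in> closure G" "(k, A k) \<in> closure G"
        using h k(1) closure_subset[of G] by (auto simp: G_def)
      show "cinner v (h, A h) = cinner v (k, A k)" if "v \<in> G" for v
        using that h k by (auto simp: G_def simp flip: graph_inner_eq)
    qed
    then show "h = k" by simp
  qed (use k in blast)
  from theI'[OF this]
  show "graph_adjoint S A f \<in> S"
    "u \<in> S \<Longrightarrow> cinner (A u) f = graph_inner A u (graph_adjoint S A f)"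
    unfolding graph_adjoint_def by blast+
qed

text \<open>The upper frame inequality is the Bessel condition. The lower one, after square roots,
  says that \<open>D\<^sup>* f\<close> dominates \<open>A\<^sup>\<sharp> f\<close>, the majorisation
  in Douglas' argument. The constants are related by
  \<open>\<gamma> = inverse (sqrt \<alpha>)\<close> and, backwards,
  \<open>\<alpha> = inverse (\<gamma>\<^sup>2 + 1)\<close>, which also allows
  \<open>\<gamma> = 0\<close>.\<close>

lemma operator_frame_iff:
  "operator_frame S A g \<longleftrightarrow> bessel_sequence UNIV cinner g \<and>
     (\<exists>\<gamma>\<ge>0. \<forall>f. graph_norm A (graph_adjoint S A f) \<le> \<gamma> * norm (analysis g f))"
proof
  assume F: "operator_frame S A g"
  then have B: "bessel_sequence UNIV cinner g"
    unfolding operator_frame_def bessel_sequence_UNIV_iff by blast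
  obtain \<alpha> where \<alpha>: "0 < \<alpha>"
      "\<And>f. \<alpha> * (graph_norm A (graph_adjoint S A f))\<^sup>2 \<le> (norm (analysis g f))\<^sup>2"
    using F unfolding operator_frame_def norm_analysis_sq[OF B] by blast
  have "graph_norm A (graph_adjoint S A f) \<le> inverse (sqrt \<alpha>) * norm (analysis g f)" for f
  proof (rule power2_le_imp_le)
    show "(graph_norm A (graph_adjoint S A f))\<^sup>2 \<le> (inverse (sqrt \<alpha>) * norm (analysis g f))\<^sup>2"
      using \<alpha>(1) \<alpha>(2)[of f] by (simp add: power_mult_distrib power_inverse field_simps)
  qed (use \<alpha> in simp)
  then show "bessel_sequence UNIV cinner g \<and>
     (\<exists>\<gamma>\<ge>0. \<forall>f. graph_norm A (graph_adjoint S A f) \<le> \<gamma> * norm (analysis g f))"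
    using B \<alpha>(1) by (intro conjI exI[of _ "inverse (sqrt \<alpha>)"]) auto
next
  assume R: "bessel_sequence UNIV cinner g \<and>
     (\<exists>\<gamma>\<ge>0. \<forall>f. graph_norm A (graph_adjoint S A f) \<le> \<gamma> * norm (analysis g f))"
  then have B: "bessel_sequence UNIV cinner g" by simp
  obtain \<beta> where \<beta>: "0 < \<beta>"
    and bessel: "\<And>f. summable (\<lambda>n. (cmod (cinner f (g n)))\<^sup>2)"
      "\<And>f. (\<Sum>n. (cmod (cinner f (g n)))\<^sup>2) \<le> \<beta> * (norm f)\<^sup>2"
    using B unfolding bessel_sequence_UNIV_iff by blast
  obtain \<gamma> where \<gamma>: "0 \<le> \<gamma>"
      "\<And>f. graph_norm A (graph_adjoint S A f) \<le> \<gamma> * norm (analysis g f)"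
    using R by blast
  have pos: "0 < \<gamma>\<^sup>2 + 1" by (simp add: add_nonneg_pos)
  have "inverse (\<gamma>\<^sup>2 + 1) * (graph_norm A (graph_adjoint S A f))\<^sup>2
      \<le> (\<Sum>n. (cmod (cinner f (g n)))\<^sup>2)" for f
  proof -
    have "(graph_norm A (graph_adjoint S A f))\<^sup>2 \<le> (\<gamma> * norm (analysis g f))\<^sup>2"
      by (intro power_mono \<gamma>) (simp add: graph_norm_eq)
    also have "\<dots> \<le> (\<gamma>\<^sup>2 + 1) * (norm (analysis g f))\<^sup>2"
      by (simp add: power_mult_distrib distrib_right)
    finally show ?thesis
      unfolding norm_analysis_sq[OF B, symmetric]
      by (simp only: mult.commute[of "inverse _"] pos_divide_le_eq[OF pos] mult.commute[of _ "_ + _"]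
          flip: divide_inverse)
  qed
  moreover have "0 < inverse (\<gamma>\<^sup>2 + 1)" using pos by simp
  ultimately show "operator_frame S A g"
    unfolding operator_frame_def using \<beta> bessel by blast
qed

text \<open>After normalisation, the vectors \<open>A\<^sup>\<sharp> f\<close> with
  \<open>\<parallel>D\<^sup>* f\<parallel> \<le> 1\<close> are weakly bounded: if \<open>A u = D c\<close>, then
  \<open>\<langle>u, A\<^sup>\<sharp> f\<rangle>\<^sub>A = \<langle>A u, f\<rangle> = \<langle>c, D\<^sup>* f\<rangle>\<close>.\<close>

lemma operator_frame_if_range_subset:
  assumes B: "bessel_sequence UNIV cinner g" and range: "A ` S \<subseteq> synthesis_range g"
  shows "operator_frame S A g"
proof -
  define P where "P f = (graph_adjoint S A f, A (graph_adjoint S A f))" for f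
  have PG: "P f \<in> G" for f using graph_adjoint(1) by (auto simp: P_def G_def)
  \<comment> \<open>A free factor \<open>s\<close>, instead of division by the norm of
    \<open>analysis g f\<close>, also treats the kernel of \<open>D\<^sup>*\<close>: there every
    multiple of \<open>P f\<close> belongs to \<open>K\<close>.\<close>
  define K where "K = {complex_of_real s *\<^sub>C P f |s f. 0 \<le> s \<and> s * norm (analysis g f) \<le> 1}"
  have "\<exists>B. \<forall>h\<in>K. cmod (cinner v h) \<le> B" if vG: "v \<in> G" for v
  proof -
    obtain u where u: "u \<in> S" and v: "v = (u, A u)"
      using vG by (auto simp: G_def)
    \<comment> \<open>The range inclusion supplies a preimage of \<open>A u\<close> under
      \<open>D\<close>. Its norm bounds the pairing of \<open>v\<close> with all of
      \<open>K\<close>, as it depends on neither \<open>s\<close> nor \<open>f\<close>.\<close>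
    obtain c where "c \<in> ell2" and c: "A u = synthesis g c"
      using range u unfolding synthesis_range_def synthesis_domain_def by auto
    then obtain a where a: "A u = synthesis g (coord a)"
      using Abs_l2_inverse by metis
    have "cmod (cinner v (complex_of_real s *\<^sub>C P f)) \<le> norm a"
      if "0 \<le> s" "s * norm (analysis g f) \<le> 1" for s f
    proof -
      have "cinner v (P f) = cinner (A u) f"
        by (simp add: v P_def graph_adjoint(2)[OF u] graph_inner_eq)
      also have "\<dots> = cnj (cinner (analysis g f) a)"
        using cinner_commute[of "A u" f] unfolding a synthesis_adjoint[OF B] .
      finally have "cmod (cinner v (P f)) \<le> norm (analysis g f) * norm a"
        using Cauchy_Schwarz_cinner by simp
      then have "cmod (cinner v (complex_of_real s *\<^sub>C P f)) \<le> s * (norm (analysis g f) * norm a)"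
        using that(1) by (simp add: cinner_scaleC_right norm_mult mult_left_mono)
      also have "\<dots> \<le> 1 * norm a"
        unfolding mult.assoc[symmetric] by (intro mult_right_mono that) simp
      finally show ?thesis by simp
    qed
    then show ?thesis unfolding K_def by blast
  qed
  moreover have "K \<subseteq> G"
    unfolding K_def using complex_vector.subspace_scale[OF subspace_G PG] by blast
  ultimately obtain \<gamma> where \<gamma>: "\<And>h. h \<in> K \<Longrightarrow> norm h \<le> \<gamma>"
    using weakly_bounded_imp_bounded[OF subspace_G closed_G] by metis
  have K: "s * norm (P f) \<le> \<gamma>" if "0 \<le> s" "s * norm (analysis g f) \<le> 1" for s f
    using \<gamma>[of "complex_of_real s *\<^sub>C P f"] that by (auto simp: K_def norm_scaleC)
  have \<gamma>0: "0 \<le> \<gamma>" using K[of 0] by simp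
  have "norm (P f) \<le> \<gamma> * norm (analysis g f)" for f
  proof (cases "analysis g f = 0")
    case True
    \<comment> \<open>Otherwise the factor \<open>(\<gamma> + 1) / norm (P f)\<close> is admissible
      and gives \<open>\<gamma> + 1 \<le> \<gamma>\<close>.\<close>
    have "norm (P f) \<le> 0"
    proof (rule ccontr)
      assume "\<not> norm (P f) \<le> 0"
      then show False
        using K[of "(\<gamma> + 1) / norm (P f)" f] True \<gamma>0 by simp
    qed
    with True show ?thesis by simp
  next
    case False
    then show ?thesis
      using K[of "inverse (norm (analysis g f))" f] by (simp add: field_simps)
  qed
  with B \<gamma>0 show ?thesis
    unfolding operator_frame_iff by (auto simp: P_def graph_norm_eq)
qed

text \<open>\<open>M u\<close> represents the functional \<open>D\<^sup>* f \<mapsto> \<langle>f, A u\<rangle>\<close>, which is well defined and bounded on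
  the range of \<open>D\<^sup>*\<close> by the lower frame bound. Being unique in the closure of that range,
  \<open>M u\<close> is linear in \<open>u\<close>.\<close>

lemma operator_frame_imp_factorization:
  assumes "operator_frame S A g"
  shows "\<exists>M. graph_bounded_linear_ell2 S A M \<and>
    (\<forall>f\<in>S. M f \<in> synthesis_domain g \<and> A f = synthesis g (M f))"
proof -
  obtain \<gamma> where B: "bessel_sequence UNIV cinner g" and \<gamma>: "0 \<le> \<gamma>"
      "\<And>f. graph_norm A (graph_adjoint S A f) \<le> \<gamma> * norm (analysis g f)"
    using assms unfolding operator_frame_iff by blast
  define R where "R = range (analysis g)"
  have R: "complex_vector.subspace R"
    unfolding complex_vector.subspace_def R_def
  proof (intro conjI ballI allI)
    show "0 \<in> range (analysis g)"
      using analysis_scaleC[OF B, of 0] by (metis complex_vector.scale_zero_left rangeI)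
  qed (auto simp flip: analysis_add[OF B] analysis_scaleC[OF B])
  have bound: "cmod (cinner f (A u)) \<le> \<gamma> * graph_norm A u * norm (analysis g f)"
    if u: "u \<in> S" for u f
  proof -
    have "cmod (cinner f (A u)) = cmod (graph_inner A u (graph_adjoint S A f))"
      using graph_adjoint(2)[OF u, of f] cinner_commute[of f "A u"] by simp
    also have "\<dots> \<le> graph_norm A u * graph_norm A (graph_adjoint S A f)"
      unfolding graph_inner_eq graph_norm_eq by (rule Cauchy_Schwarz_cinner)
    also have "\<dots> \<le> graph_norm A u * (\<gamma> * norm (analysis g f))"
      by (intro mult_left_mono \<gamma>) (simp add: graph_norm_eq)
    finally show ?thesis by (simp add: mult_ac)
  qed
  have "\<exists>a\<in>closure R. (\<forall>f. cinner f (A u) = cinner (analysis g f) a)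
      \<and> norm a \<le> \<gamma> * graph_norm A u" if u: "u \<in> S" for u
  proof -
    \<comment> \<open>The choice of preimage is harmless: two preimages differ by a vector that
      \<open>D\<^sup>*\<close> annihilates, and by \<open>bound\<close> such a vector is orthogonal
      to \<open>A u\<close>.\<close>
    define \<phi> where "\<phi> x = cinner (SOME f. analysis g f = x) (A u)" for x
    have \<phi>: "\<phi> (analysis g f) = cinner f (A u)" for f
    proof -
      define h where "h = (SOME h. analysis g h = analysis g f)"
      have "analysis g h = analysis g f" unfolding h_def by (rule someI[of _ f]) simp
      then have "cmod (cinner (h - f) (A u)) \<le> 0"
        using bound[OF u, of "h - f"] by (simp add: analysis_diff[OF B])
      then show ?thesis by (simp add: \<phi>_def h_def[symmetric] cinner.diff_left)
    qed
    show ?thesis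
    proof (rule riesz_representation[OF R, of \<phi> "\<gamma> * graph_norm A u"])
      show "0 \<le> \<gamma> * graph_norm A u" using \<gamma>(1) by (simp add: graph_norm_eq)
      show "cmod (\<phi> v) \<le> \<gamma> * graph_norm A u * norm v" if "v \<in> R" for v
        using that bound[OF u] by (auto simp: R_def \<phi>)
      show "\<phi> (v + w) = \<phi> v + \<phi> w" if "v \<in> R" "w \<in> R" for v w
        using that by (auto simp: R_def \<phi> cinner_add_left simp flip: analysis_add[OF B])
      show "\<phi> (c *\<^sub>C v) = c * \<phi> v" if "v \<in> R" for c v
        using that by (auto simp: R_def \<phi> cinner_scaleC_left simp flip: analysis_scaleC[OF B])
    next
      fix a assume "a \<in> closure R" "\<And>v. v \<in> R \<Longrightarrow> \<phi> v = cinner v a"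
        "norm a \<le> \<gamma> * graph_norm A u"
      then show ?thesis by (auto simp: R_def simp flip: \<phi>)
    qed
  qed
  then obtain a where aR: "\<And>u. u \<in> S \<Longrightarrow> a u \<in> closure R"
    and a: "\<And>u f. u \<in> S \<Longrightarrow> cinner (analysis g f) (a u) = cinner f (A u)"
    and a_norm: "\<And>u. u \<in> S \<Longrightarrow> norm (a u) \<le> \<gamma> * graph_norm A u"
    by metis
  note cR = csubspace_closure[OF R]
  have add: "a (u + w) = a u + a w" if "u \<in> S" "w \<in> S" for u w
    using that complex_vector.subspace_add[OF subspace_S that]
    by (intro cinner_eq_closure_imp_eq[OF R] aR complex_vector.subspace_add[OF cR])
      (auto simp: R_def a A_add cinner_add_right)
  have scale: "a (c *\<^sub>C u) = c *\<^sub>C a u" if "u \<in> S" for c u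
    using that complex_vector.subspace_scale[OF subspace_S that]
    by (intro cinner_eq_closure_imp_eq[OF R] aR complex_vector.subspace_scale[OF cR])
      (auto simp: R_def a A_scaleC cinner_scaleC_right)
  \<comment> \<open>Moving \<open>D\<close> across the inner product turns the defining property of
    \<open>a u\<close> into equality of all pairings with \<open>D (a u)\<close> and
    \<open>A u\<close>.\<close>
  have "synthesis g (coord (a u)) = A u" if "u \<in> S" for u
  proof (rule cinner_eq_closure_imp_eq[of UNIV])
    show "cinner v (synthesis g (coord (a u))) = cinner v (A u)" for v
      using a[OF that] by (simp add: synthesis_adjoint[OF B])
  qed auto
  moreover have "graph_bounded_linear_ell2 S A (\<lambda>u. coord (a u))"
    unfolding graph_bounded_linear_ell2_def
    using coord a_norm by (auto simp: add scale coord_add coord_scaleC norm_l2_def)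
  ultimately show ?thesis
    using summable_synthesis[OF B coord] coord
    by (intro exI[of _ "\<lambda>u. coord (a u)"]) (auto simp: synthesis_domain_def)
qed

text \<open>Each coordinate of \<open>M\<close> is a functional bounded in the graph norm, hence
  represented by some \<open>k n\<close>. The squared pairings with the \<open>k n\<close> then add
  up to the squared norm of \<open>M f\<close>, so the bound of \<open>M\<close> is the Bessel
  bound.\<close>

lemma graph_bounded_linear_ell2_imp_bessel:
  assumes M: "graph_bounded_linear_ell2 S A M"
  obtains k where "bessel_sequence S (graph_inner A) k"
    "\<And>f n. f \<in> S \<Longrightarrow> M f n = graph_inner A f (k n)"
proof -
  obtain C where M_ell2: "\<And>f. f \<in> S \<Longrightarrow> M f \<in> ell2"
    and C: "\<And>f. f \<in> S \<Longrightarrow> ell2_norm (M f) \<le> C * graph_norm A f"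
    using M unfolding graph_bounded_linear_ell2_def by blast
  have "cmod (M f n) \<le> C * graph_norm A f" if "f \<in> S" for f n
    using cmod_coord_le[of "Abs_l2 (M f)" n] C[OF that] M_ell2[OF that]
    by (simp add: norm_l2_def Abs_l2_inverse)
  then have "\<exists>k\<in>S. \<forall>f\<in>S. M f n = graph_inner A f k" for n
    using M by (intro riesz_graph[of _ C]) (auto simp: graph_bounded_linear_ell2_def)
  then obtain k where k: "\<And>n. k n \<in> S" "\<And>f n. f \<in> S \<Longrightarrow> M f n = graph_inner A f (k n)"
    by metis
  have eq: "(\<lambda>n. graph_inner A f (k n)) = M f" if "f \<in> S" for f
    using k(2)[OF that] by auto
  have "summable (\<lambda>n. (cmod (graph_inner A f (k n)))\<^sup>2)"
    "(\<Sum>n. (cmod (graph_inner A f (k n)))\<^sup>2) \<le> (C\<^sup>2 + 1) * (graph_norm A f)\<^sup>2"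
    if f: "f \<in> S" for f
  proof -
    show s: "summable (\<lambda>n. (cmod (graph_inner A f (k n)))\<^sup>2)"
      using M_ell2[OF f] by (simp add: ell2_def flip: k(2)[OF f])
    have "(\<Sum>n. (cmod (graph_inner A f (k n)))\<^sup>2) = (ell2_norm (M f))\<^sup>2"
      using s by (simp add: ell2_norm_def k(2)[OF f] suminf_nonneg)
    also have "\<dots> \<le> (C * graph_norm A f)\<^sup>2"
      using C[OF f] ell2_norm_nonneg[OF M_ell2[OF f]] by (rule power_mono)
    also have "\<dots> \<le> (C\<^sup>2 + 1) * (graph_norm A f)\<^sup>2"
      by (simp add: power_mult_distrib distrib_right)
    finally show "(\<Sum>n. (cmod (graph_inner A f (k n)))\<^sup>2) \<le> (C\<^sup>2 + 1) * (graph_norm A f)\<^sup>2" .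
  qed
  then have "bessel_sequence S (graph_inner A) k"
    unfolding bessel_sequence_def graph_norm_def[symmetric]
    using k(1) by (intro conjI allI exI[of _ "C\<^sup>2 + 1"]) (simp_all add: add_nonneg_pos)
  with k(2) that show ?thesis by blast
qed

text \<open>The coefficients \<open>graph_inner A f (k n)\<close> serve as \<open>a_f\<close>, with
  \<open>\<gamma>\<close> the square root of the Bessel bound of \<open>k\<close>.\<close>

lemma atomic_system_if_dual_bessel:
  assumes "bessel_sequence UNIV cinner g" and "bessel_sequence S (graph_inner A) k"
    and "\<And>f. f \<in> S \<Longrightarrow> (\<lambda>n. graph_inner A f (k n) *\<^sub>C g n) sums A f"
  shows "atomic_system S A g"
proof -
  obtain \<beta> where \<beta>: "0 < \<beta>" and bessel:
    "\<forall>f\<in>S. summable (\<lambda>n. (cmod (graph_inner A f (k n)))\<^sup>2) \<and>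
       (\<Sum>n. (cmod (graph_inner A f (k n)))\<^sup>2) \<le> \<beta> * (graph_norm A f)\<^sup>2"
    using assms(2) unfolding bessel_sequence_def graph_norm_def[symmetric] by (elim conjE exE)
  have "ell2_norm (\<lambda>n. graph_inner A f (k n)) \<le> sqrt \<beta> * graph_norm A f" if "f \<in> S" for f
    using real_sqrt_le_mono[OF bessel[rule_format, OF that, THEN conjunct2]]
    by (simp add: ell2_norm_def real_sqrt_mult graph_norm_eq)
  moreover have "(\<lambda>n. graph_inner A f (k n)) \<in> ell2" if "f \<in> S" for f
    using bessel that by (simp add: ell2_def)
  ultimately show ?thesis
    unfolding atomic_system_def using assms(1,3) \<beta>
    by (intro conjI exI[of _ "sqrt \<beta>"]) auto
qed

lemma atomic_system_imp_range_subset: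
  assumes "atomic_system S A g"
  shows "A ` S \<subseteq> synthesis_range g"
proof
  fix y assume "y \<in> A ` S"
  then obtain a where "a \<in> ell2" "(\<lambda>n. a n *\<^sub>C g n) sums y"
    using assms unfolding atomic_system_def by blast
  then show "y \<in> synthesis_range g"
    by (auto simp: synthesis_range_def synthesis_domain_def synthesis_def sums_iff)
qed

end

section \<open>Assembling the cycle of implications\<close>

theorem corollary4p8:
  fixes S :: "'a::complex_hilbert set"
    and A :: "'a \<Rightarrow> 'a"
    and g :: "nat \<Rightarrow> 'a"
  assumes "infinite_dimensional TYPE('a)"
    and "closed_densely_defined_operator S A"
  shows
    "(atomic_system S A g \<longleftrightarrow> operator_frame S A g) \<and>
     (operator_frame S A g \<longleftrightarrow>
        bessel_sequence UNIV cinner g \<and>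
        (\<exists>k. bessel_sequence S (graph_inner A) k \<and>
           (\<forall>f\<in>S. (\<lambda>n. graph_inner A f (k n) *\<^sub>C g n) sums A f))) \<and>
     (operator_frame S A g \<longleftrightarrow>
        synthesis_bounded_everywhere_defined g \<and> A ` S \<subseteq> synthesis_range g) \<and>
     (operator_frame S A g \<longleftrightarrow>
        synthesis_bounded_everywhere_defined g \<and>
        (\<exists>M. graph_bounded_linear_ell2 S A M \<and>
           (\<forall>f\<in>S. M f \<in> synthesis_domain g \<and> A f = synthesis g (M f))))"
  (is "(?i \<longleftrightarrow> ?ii) \<and> (_ \<longleftrightarrow> ?iii) \<and> (_ \<longleftrightarrow> ?iv) \<and> (_ \<longleftrightarrow> ?v)")
proof -
  interpret closed_operator S A using assms(2) by unfold_locales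
  \<comment> \<open>Oriented so that boundedness of \<open>D\<close> in (iv) and (v) is rewritten to
    the Bessel condition that the other statements contain.\<close>
  note bessel_iff = bessel_sequence_iff_synthesis_bounded[of g, symmetric]
  have "?iv" if ?i
    using that atomic_system_imp_range_subset by (simp add: bessel_iff atomic_system_def)
  moreover have "?ii" if ?iv
    using that operator_frame_if_range_subset by (simp add: bessel_iff)
  moreover have "?v" if ?ii
    using that operator_frame_imp_factorization by (simp add: bessel_iff operator_frame_iff)
  moreover have "?iii" if v: ?v
  proof -
    obtain M where B: "bessel_sequence UNIV cinner g" and M: "graph_bounded_linear_ell2 S A M"
      and AM: "\<And>f. f \<in> S \<Longrightarrow> M f \<in> synthesis_domain g" "\<And>f. f \<in> S \<Longrightarrow> A f = synthesis g (M f)"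
      using v unfolding bessel_iff by blast
    obtain k where k: "bessel_sequence S (graph_inner A) k"
      "\<And>f n. f \<in> S \<Longrightarrow> M f n = graph_inner A f (k n)"
      using graph_bounded_linear_ell2_imp_bessel[OF M] by blast
    have "(\<lambda>n. graph_inner A f (k n) *\<^sub>C g n) sums A f" if "f \<in> S" for f
      using AM[OF that] by (auto simp: synthesis_def synthesis_domain_def sums_iff k(2)[OF that])
    with B k(1) show ?thesis by blast
  qed
  moreover have "?i" if ?iii
    using that atomic_system_if_dual_bessel by blast
  ultimately show ?thesis by argo
qed

end
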